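(* Let $A=(a_{ij})\in\mathbf{RM}_7$ and $\xi_j=(|a_{j,j+1}|-|a_{j+1,j}|)^2/4$, $j=1,\dots,6$. Then $C(A)$ contains an ellipse $E$ with the foci $\sqrt{2+\sqrt2}$ and $-\sqrt{2-\sqrt2}$ (equivalently, $\sqrt{2-\sqrt2}$ and $-\sqrt{2+\sqrt2}$) if and only if for some $t>0$ the $6$-tuple $(\xi_1,\dots,\xi_6)$ equals $t\vec\xi_1$ or $t\vec\xi_2$, where $$\vec\xi_1=\left(2(\sqrt2-1),\,3-2\sqrt2,\,0,\,1,\,0,\,1\right),\qquad \vec\xi_2=\left(\sqrt2+1,\,0,\,\sqrt2+1,\,0,\,\sqrt2-1,\,2\right).$$ If this is the case, then in fact $C(A)=E\cup(-E)\cup E_0\cup\{0\}$, with $E_0$ being an ellipse with the foci $\pm\sqrt2$. Moreover, the minor axes of $\pm E$ and $E_0$ are of the same length.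
   Context: $\mathbf{RM}_7$ is the set of complex $7\times 7$ tridiagonal matrices $A=(a_{ij})$ with zero main diagonal and $a_{i,i+1}a_{i+1,i}=1$ for $i=1,\dots,6$ (reciprocal matrices). For a square matrix $A$, $\operatorname{Re}A=(A+A^* )/2$; the Kippenhahn polynomial of $A$ is $P_A(\lambda,\theta)=\det(\operatorname{Re}(e^{i\theta}A)-\lambda I)$, and the Kippenhahn curve $C(A)$ is the envelope of the family of lines $\{e^{-i\theta}(\lambda_j(\theta)+i\mathbb R):\theta\in(-\pi,\pi],\ j=1,\dots,7\}$, where $\lambda_j(\theta)$ are the roots of $P_A(\cdot,\theta)$. $C(A)$ contains the ellipse with center $p\in\mathbb R$, foci $p\pm X$ ($X\ge0$) and minor half-axis $c>0$ if and only if $P_A$ is divisible by $(\lambda-p\cos\theta)^2-(X^2\cos^2\theta+c^2)$ (as polynomials in $\lambda$ and $\cos\theta$). Ellipses are genuine (non-degenerate): $c>0$. The equality $C(A)=E\cup(-E)\cup E_0\cup\{0\}$ means that $P_A$ is, up to sign, the product of the three quadratic factors corresponding to $E$, $-E$, $E_0$ and the factor $\lambda$ (corresponding to the point $0$). *)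

theory Defs
  imports Complex_Main "Jordan_Normal_Form.Schur_Decomposition"
begin

text \<open>Matrix entries are indexed from 0, so the entry usually written \<open>a\<^sub>i\<^sub>j\<close> with
  \<open>1 \<le> i, j \<le> n\<close> is \<open>A $$ (i - 1, j - 1)\<close>.\<close>

definition reciprocal_mats :: "nat \<Rightarrow> complex mat set" where
  "reciprocal_mats n = {A \<in> carrier_mat n n.
     (\<forall>i<n. \<forall>j<n. i + 1 < j \<or> j + 1 < i \<longrightarrow> A $$ (i, j) = 0) \<and>
     (\<forall>i<n. A $$ (i, i) = 0) \<and>
     (\<forall>i. i + 1 < n \<longrightarrow> A $$ (i, i + 1) * A $$ (i + 1, i) = 1)}"

text \<open>The argument \<open>j\<close> of \<open>xi\<close> runs over \<open>1, \<dots>, n - 1\<close>.\<close>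

definition xi :: "complex mat \<Rightarrow> nat \<Rightarrow> real" where
  "xi A j = (cmod (A $$ (j - 1, j)) - cmod (A $$ (j, j - 1)))\<^sup>2 / 4"

definition re_mat :: "complex mat \<Rightarrow> complex mat" where
  "re_mat A = (1 / 2) \<cdot>\<^sub>m (A + mat_adjoint A)"

definition kippenhahn_poly :: "complex mat \<Rightarrow> complex \<Rightarrow> real \<Rightarrow> complex" where
  "kippenhahn_poly A x \<theta> = det (re_mat (cis \<theta> \<cdot>\<^sub>m A) - x \<cdot>\<^sub>m (1\<^sub>m (dim_row A)))"

text \<open>The line \<open>exp (- \<i> \<theta>) * (\<mu> + \<i> \<real>)\<close> is \<open>{z. Re (cis \<theta> * z) = \<mu>}\<close>. For a
  differentiable branch \<open>\<mu>\<close> of eigenvalues, the envelope of the corresponding lines consists of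
  the points satisfying this equation together with its derivative with respect to \<open>\<theta>\<close>,
  that is, \<open>z = exp (- \<i> \<theta>) * (\<mu> \<theta> - \<i> * \<mu>' \<theta>)\<close>. Branches are taken locally and without fixing
  an ordering of the eigenvalues, so that they may pass through eigenvalue crossings; in
  particular, a line belonging to a multiple eigenvalue is not itself part of the curve.\<close>

definition kippenhahn_curve :: "complex mat \<Rightarrow> complex set" where
  "kippenhahn_curve A = {z. \<exists>\<theta> \<mu> \<mu>'.
     (\<forall>\<^sub>F s in nhds \<theta>. kippenhahn_poly A (complex_of_real (\<mu> s)) s = 0) \<and>
     (\<mu> has_real_derivative \<mu>') (at \<theta>) \<and>
     Re (cis \<theta> * z) = \<mu> \<theta> \<and> Re (\<i> * cis \<theta> * z) = \<mu>'}"

text \<open>\<open>ellipse f g c\<close> has the (real) foci \<open>f\<close>, \<open>g\<close> and the minor half-axis \<open>c\<close>; its major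
  half-axis is \<open>sqrt (X\<^sup>2 + c\<^sup>2)\<close>, where \<open>X\<close> is half the distance between the foci. It is a
  genuine ellipse for \<open>c > 0\<close>.\<close>

definition ellipse :: "real \<Rightarrow> real \<Rightarrow> real \<Rightarrow> complex set" where
  "ellipse f g c = {z. cmod (z - complex_of_real f) + cmod (z - complex_of_real g) =
     2 * sqrt ((\<bar>f - g\<bar> / 2)\<^sup>2 + c\<^sup>2)}"

text \<open>The factor of the Kippenhahn polynomial belonging to \<open>ellipse f g c\<close>, namely
  \<open>(x - p * cos \<theta>)\<^sup>2 - (X\<^sup>2 * (cos \<theta>)\<^sup>2 + c\<^sup>2)\<close> with centre \<open>p\<close> and foci \<open>p \<plusminus> X\<close>.\<close>

definition ellipse_factor :: "real \<Rightarrow> real \<Rightarrow> real \<Rightarrow> complex \<Rightarrow> real \<Rightarrow> complex" where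
  "ellipse_factor f g c x \<theta> =
     (x - complex_of_real ((f + g) / 2 * cos \<theta>))\<^sup>2
       - complex_of_real ((\<bar>f - g\<bar> / 2)\<^sup>2 * (cos \<theta>)\<^sup>2 + c\<^sup>2)"

definition xi_vec1 :: "real list" where
  "xi_vec1 = [2 * (sqrt 2 - 1), 3 - 2 * sqrt 2, 0, 1, 0, 1]"

definition xi_vec2 :: "real list" where
  "xi_vec2 = [sqrt 2 + 1, 0, sqrt 2 + 1, 0, sqrt 2 - 1, 2]"

end

theory Submission
  imports Defs "HOL-Analysis.Change_Of_Vars"
begin

text \<open>
  \<open>Re (exp (i \<theta>) A)\<close> is tridiagonal with squared off-diagonal moduli \<open>\<tau> + \<xi>\<^sub>j\<close>, where
  \<open>\<tau> = cos\<^sup>2 \<theta>\<close>. Hence \<open>P\<^sub>A\<close> is, up to sign, \<open>\<lambda>\<close> times a cubic in \<open>\<lambda>\<^sup>2\<close> and \<open>\<tau>\<close>, and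
  its roots are simple as long as all \<open>\<tau> + \<xi>\<^sub>j\<close> are positive.

  If the curve contains \<open>E\<close>, then by Sard's theorem infinitely many of the lines enveloping the
  curve are tangent to \<open>E\<close>. The factor of \<open>E\<close> then has a root in common with \<open>P\<^sub>A\<close> for infinitely
  many \<open>\<theta>\<close>, and since the discriminant of the quadratic in \<open>\<lambda>\<^sup>2\<close> belonging to \<open>E\<close> and \<open>-E\<close> is
  not a square, this quadratic divides the cubic. Comparing coefficients gives six equations for
  \<open>\<xi>\<close> and the remaining linear factor. They imply that for \<open>\<tau> = 0\<close> the cubic has a double root,
  so some \<open>\<xi>\<^sub>j\<close> vanishes, the matrix decouples, and the equations can be solved.
\<close>

section \<open>The characteristic polynomial of a weighted path\<close>

text \<open>The foci are not arbitrary. \<open>A\<close> is diagonally similar to the adjacency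
  matrix of a path, and its nonzero eigenvalues have the squares
  \<open>2 \<plusminus> sqrt 2\<close> and \<open>2\<close>. The foci of \<open>E\<close> and
  \<open>-E\<close> use up the first two squares, which forces the foci of the remaining factor and
  leaves only its constant \<open>k\<close> open. The main obstacle is that the curve is a mere set
  of points: each point comes with an angle and a local branch of its own, and nothing makes these
  depend continuously on the point of \<open>E\<close>. Containment therefore provides no arc along
  which two branches could be compared. A measure argument copes with this, since it admits
  arbitrary parameter sets and needs only simple roots and countably many neighbourhoods. The angles
  with \<open>cos \<theta> = 0\<close>, where roots may be multiple, are set aside: they account for
  finitely many values of \<open>Im z\<close> only.\<close>

definition match1 :: "(nat \<Rightarrow> 'a::comm_ring_1) \<Rightarrow> 'a" where
  "match1 w = w 1 + w 2 + w 3 + w 4 + w 5 + w 6"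

definition match2 :: "(nat \<Rightarrow> 'a::comm_ring_1) \<Rightarrow> 'a" where
  "match2 w = w 1 * (w 3 + w 4 + w 5 + w 6) + w 2 * (w 4 + w 5 + w 6) + w 3 * (w 5 + w 6) + w 4 * w 6"

definition match3 :: "(nat \<Rightarrow> 'a::comm_ring_1) \<Rightarrow> 'a" where
  "match3 w = w 1 * w 3 * w 5 + w 1 * w 3 * w 6 + w 1 * w 4 * w 6 + w 2 * w 4 * w 6"

text \<open>The polynomial \<open>path_poly w\<close> is the characteristic polynomial of a Hermitian tridiagonal
  matrix with zero diagonal and squared off-diagonal moduli \<open>w 1, \<dots>, w 6\<close>; its coefficients are
  sums over the matchings of the path with seven vertices.\<close>

definition path_poly :: "(nat \<Rightarrow> 'a::comm_ring_1) \<Rightarrow> 'a \<Rightarrow> 'a" where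
  "path_poly w x = x ^ 7 - match1 w * x ^ 5 + match2 w * x ^ 3 - match3 w * x"

definition path_poly' :: "(nat \<Rightarrow> 'a::comm_ring_1) \<Rightarrow> 'a \<Rightarrow> 'a" where
  "path_poly' w x = 7 * x ^ 6 - 5 * match1 w * x ^ 4 + 3 * match2 w * x ^ 2 - match3 w"

lemmas match_defs = match1_def match2_def match3_def

text \<open>Sturm's argument: \<open>D2\<close>, ..., \<open>D6\<close> are the characteristic
  polynomials of the leading blocks at \<open>x\<close>, \<open>E2\<close>, ..., \<open>E6\<close>
  their derivatives, and the Wronskian of two neighbours stays positive because the next one is
  \<open>d1\<^sup>2 + v * W\<close>. If \<open>w 6 = 0\<close>, the last vertex splits off and
  contributes another root 0, whence the condition \<open>nz\<close>.\<close>

lemma path_poly_roots_simple: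
  fixes w :: "nat \<Rightarrow> real"
  assumes pos: "0 < w 1" "0 < w 2" "0 < w 3" "0 < w 4" "0 < w 5" "0 \<le> w 6"
    and nz: "x \<noteq> 0 \<or> 0 < w 6"
    and root: "path_poly w x = 0"
  shows "path_poly' w x \<noteq> 0"
proof
  assume root': "path_poly' w x = 0"
  define D2 E2 where "D2 = x\<^sup>2 - w 1" and "E2 = 2 * x"
  define D3 E3 where "D3 = x * D2 - w 2 * x" and "E3 = D2 + x * E2 - w 2"
  define D4 E4 where "D4 = x * D3 - w 3 * D2" and "E4 = D3 + x * E3 - w 3 * E2"
  define D5 E5 where "D5 = x * D4 - w 4 * D3" and "E5 = D4 + x * E4 - w 4 * E3"
  define D6 E6 where "D6 = x * D5 - w 5 * D4" and "E6 = D5 + x * E5 - w 5 * E4"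
  note ds = D2_def E2_def D3_def E3_def D4_def E4_def D5_def E5_def D6_def E6_def
  have q: "path_poly w x = x * D6 - w 6 * D5"
    unfolding ds path_poly_def match_defs by Groebner_Basis.algebra
  have q': "path_poly' w x = D6 + x * E6 - w 6 * E5"
    unfolding ds path_poly'_def match_defs by Groebner_Basis.algebra
  have "E2 * x - D2 = x\<^sup>2 + w 1" unfolding ds by Groebner_Basis.algebra
  then have W2: "E2 * x - D2 > 0" using pos by (simp add: add_nonneg_pos)
  have step: "(d1 + x * e1 - v * e0) * d1 - (x * d1 - v * d0) * e1 > 0"
    if "e1 * d0 - d1 * e0 > 0" "v > 0" for d0 d1 e0 e1 v
  proof -
    have "(d1 + x * e1 - v * e0) * d1 - (x * d1 - v * d0) * e1 = d1\<^sup>2 + v * (e1 * d0 - d1 * e0)"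
      by Groebner_Basis.algebra
    then show ?thesis using that by (simp add: add_nonneg_pos)
  qed
  have W3: "E3 * D2 - D3 * E2 > 0"
    unfolding D3_def E3_def using step[of E2 x D2 1 "w 2"] W2 pos by (simp add: algebra_simps)
  have W4: "E4 * D3 - D4 * E3 > 0"
    unfolding D4_def E4_def using step[OF W3] pos by blast
  have W5: "E5 * D4 - D5 * E4 > 0"
    unfolding D5_def E5_def using step[OF W4] pos by blast
  have W6: "E6 * D5 - D6 * E5 > 0"
    unfolding D6_def E6_def using step[OF W5] pos by blast
  have "D6\<^sup>2 + w 6 * (E6 * D5 - D6 * E5) = path_poly' w x * D6 - path_poly w x * E6"
    unfolding q q' by Groebner_Basis.algebra
  then have "D6\<^sup>2 + w 6 * (E6 * D5 - D6 * E5) = 0" using root root' by simp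
  moreover have "w 6 * (E6 * D5 - D6 * E5) \<ge> 0" using pos W6 by simp
  ultimately have "D6\<^sup>2 = 0 \<and> w 6 * (E6 * D5 - D6 * E5) = 0"
    by (metis add_nonneg_eq_0_iff zero_le_power2)
  then have D6: "D6 = 0" and "w 6 = 0" using W6 by auto
  with nz q' root' have "E6 = 0" by auto
  with D6 W6 show False by simp
qed

lemma path_poly_rev: "path_poly (\<lambda>j. w (7 - j)) x = path_poly w x"
  unfolding path_poly_def match_defs by (simp add: algebra_simps)

lemma path_poly'_rev: "path_poly' (\<lambda>j. w (7 - j)) x = path_poly' w x"
  unfolding path_poly'_def match_defs by (simp add: algebra_simps)

text \<open>The coefficient equations for minor half-axis 1, where \<open>\<lambda>\<^sup>2 - 2 * \<tau> - k\<close> is the cofactor of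
  the quadratic in \<open>\<lambda>\<^sup>2\<close> belonging to \<open>E\<close> and \<open>-E\<close>.\<close>

locale xi_equations =
  fixes \<xi> :: "nat \<Rightarrow> real" and k s :: real
  assumes s: "s = 2 * sqrt 2 - 2"
    and nonneg: "\<And>j. 0 \<le> \<xi> j"
    and sum16: "\<xi> 1 + \<xi> 6 = k + s"
    and sum25: "\<xi> 2 + \<xi> 5 = k - s"
    and sum34: "\<xi> 3 + \<xi> 4 = 2 - k"
    and m2: "match2 \<xi> = 1 + 2 * k"
    and m3: "match3 \<xi> = k"
    and mixed: "\<xi> 1 * \<xi> 3 + \<xi> 1 * \<xi> 6 + \<xi> 4 * \<xi> 6 - \<xi> 2 * \<xi> 5 = 1 + s * k"
begin

lemma s_sq: "s\<^sup>2 = 4 - 4 * s"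
  unfolding s by (simp add: power2_eq_square algebra_simps)

lemma s_bounds: "0.82 < s" "s < 0.829"
proof -
  have "1.41 < sqrt 2" by (rule real_less_rsqrt) (simp add: power2_eq_square)
  moreover have "sqrt 2 < 1.4145" by (rule real_less_lsqrt) (auto simp: power2_eq_square)
  ultimately show "0.82 < s" "s < 0.829" unfolding s by auto
qed

lemma reversed: "xi_equations (\<lambda>j. \<xi> (7 - j)) k s"
proof
  show "match2 (\<lambda>j. \<xi> (7 - j)) = 1 + 2 * k" using m2 by (simp add: match2_def algebra_simps)
  show "match3 (\<lambda>j. \<xi> (7 - j)) = k" using m3 by (simp add: match3_def algebra_simps)
qed (use s nonneg sum16 sum25 sum34 mixed in \<open>simp_all add: algebra_simps\<close>)

lemma path_poly_1: "path_poly \<xi> 1 = 0" "path_poly' \<xi> 1 = 0"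
proof -
  have "match1 \<xi> = 2 + k" using sum16 sum25 sum34 by (simp add: match1_def)
  then show "path_poly \<xi> 1 = 0" "path_poly' \<xi> 1 = 0"
    unfolding path_poly_def path_poly'_def m2 m3 by simp_all
qed

text \<open>The root 1 is double, so simplicity must fail. A vanishing end weight alone cannot be
  the cause: it only detaches a vertex, which adds the root 0 and not 1. If all interior weights are
  positive, then \<open>k > s\<close>, so at least one end weight is positive too; reversal of the
  path lets this be the first one.\<close>

lemma some_zero: "\<xi> 2 = 0 \<or> \<xi> 3 = 0 \<or> \<xi> 4 = 0 \<or> \<xi> 5 = 0"
proof (rule ccontr)
  assume "\<not> ?thesis"
  then have pos: "\<xi> 2 > 0" "\<xi> 3 > 0" "\<xi> 4 > 0" "\<xi> 5 > 0"
    using nonneg by (metis less_eq_real_def)+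
  have "k - s > 0" using sum25 pos by simp
  then have "\<xi> 1 + \<xi> 6 > 0" using sum16 s_bounds by simp
  then have "\<xi> 1 > 0 \<or> \<xi> 6 > 0" using nonneg[of 1] nonneg[of 6] by linarith
  then show False
  proof
    assume "\<xi> 1 > 0"
    then show False using path_poly_roots_simple[of \<xi> 1] pos path_poly_1 nonneg by simp
  next
    assume "\<xi> 6 > 0"
    then show False
      using path_poly_roots_simple[of "\<lambda>j. \<xi> (7 - j)" 1] pos path_poly_1 nonneg
      by (simp add: path_poly_rev path_poly'_rev)
  qed
qed

text \<open>If \<open>\<xi> 3 = 0\<close>, then the path splits into the edges 1, 2 and 4, 5, 6, so that, for
  \<open>\<tau> = 0\<close> and \<open>y = \<lambda>\<^sup>2\<close>,
  \<open>(y - \<xi> 1 - \<xi> 2) * (y\<^sup>2 - (\<xi> 4 + \<xi> 5 + \<xi> 6) * y + \<xi> 4 * \<xi> 6) = (y - 1)\<^sup>2 * (y - k)\<close>.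
  Similarly for \<open>\<xi> 2 = 0\<close>.\<close>

lemma case_3:
  assumes c: "\<xi> 3 = 0"
  shows "\<xi> 1 = s" "\<xi> 2 = 1 - s" "\<xi> 4 = 1" "\<xi> 5 = 0" "\<xi> 6 = 1" "k = 1"
proof -
  define a b d g f where defs: "a = \<xi> 1" "b = \<xi> 2" "d = \<xi> 4" "g = \<xi> 5" "f = \<xi> 6"
  have nn: "a \<ge> 0" "b \<ge> 0" "d \<ge> 0" "g \<ge> 0" "f \<ge> 0" unfolding defs using nonneg by auto
  have e: "a = k + s - f" "b = k - s - g" "d = 2 - k"
    using sum16 sum25 sum34 c defs by auto
  have m2': "(a + b) * (d + g + f) + d * f = 1 + 2 * k"
    using m2 c unfolding match2_def defs by (simp add: algebra_simps)
  have m3': "(a + b) * (d * f) = k"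
    using m3 c unfolding match3_def defs by (simp add: algebra_simps)
  have mx: "a * f + d * f - b * g = 1 + s * k" using mixed c unfolding defs by simp
  have sm: "(a + b) + (d + g + f) = 2 + k" using e by simp
  have "((a + b) - 1)\<^sup>2 * ((a + b) - k) = 0" using m2' m3' sm by Groebner_Basis.algebra
  then have "a + b = 1 \<or> a + b = k" by auto
  then have ab: "a + b = 1"
  proof
    assume ab: "a + b = k"
    have "k \<ge> s" using e nn by simp
    then have "k \<noteq> 0" using s_bounds by simp
    then have "d * f = 1" using m3' ab by simp
    moreover have "d + g + f = 2" using sm ab by simp
    \<comment> \<open>This is \<open>(d + g + f)\<^sup>2 = 4 * (d * f)\<close>, the vanishing
      discriminant of the remaining quadratic factor \<open>(y - 1)\<^sup>2\<close>.\<close>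
    ultimately have "(d - f)\<^sup>2 + g * (d + f + 2) = 0" by Groebner_Basis.algebra
    moreover have "g * (d + f + 2) \<ge> 0" using nn by simp
    ultimately have "(d - f)\<^sup>2 = 0 \<and> g * (d + f + 2) = 0"
      by (metis add_nonneg_eq_0_iff zero_le_power2)
    then have "d = f" "g = 0" using nn by auto
    then have "d = 1" using \<open>d + g + f = 2\<close> by simp
    then have "k = 1" using e by simp
    then show ?thesis using ab by simp
  qed
  have g: "g = 2 * k - 1 - f" using ab e by simp
  have df: "(2 - k) * f = k" using m3' ab e by simp
  have "(k - 1) * (2 * k + s - 2 * f) = 0"
    using mx g df e ab by Groebner_Basis.algebra
  then have "k = 1"
  proof (simp, elim disjE)
    \<comment> \<open>This factor cannot vanish: \<open>g \<ge> 0\<close> would give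
      \<open>k \<ge> 1 + s / 2\<close>, and then \<open>k * (k - 1 + s / 2)\<close> would exceed its
      value \<open>s\<close>.\<close>
    assume "2 * k + s = 2 * f"
    then have f: "f = k + s / 2" by simp
    with g nn have k: "k \<ge> 1 + s / 2" by simp
    have "(2 - k) * (k + s / 2) = k" using df f by simp
    then have "k * (k - 1 + s / 2) = s" by (simp add: field_simps)
    moreover have "k * (k - 1 + s / 2) \<ge> (1 + s / 2) * s"
      by (rule mult_mono) (use k s_bounds in auto)
    moreover have "(1 + s / 2) * s = s + s\<^sup>2 / 2" by Groebner_Basis.algebra
    moreover have "s\<^sup>2 > 0" using s_bounds by simp
    ultimately show "k = 1" by linarith
  qed simp
  then have "f = 1" "g = 0" "d = 1" "a = s" "b = 1 - s" using df g e by auto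
  then show "\<xi> 1 = s" "\<xi> 2 = 1 - s" "\<xi> 4 = 1" "\<xi> 5 = 0" "\<xi> 6 = 1" "k = 1"
    using defs \<open>k = 1\<close> by auto
qed

lemma case_2:
  assumes b: "\<xi> 2 = 0"
  shows "\<xi> 1 = 1" "\<xi> 3 = 1" "\<xi> 4 = 0" "\<xi> 5 = 1 - s" "\<xi> 6 = s" "k = 1"
proof -
  define a c d g f where defs: "a = \<xi> 1" "c = \<xi> 3" "d = \<xi> 4" "g = \<xi> 5" "f = \<xi> 6"
  have nn: "a \<ge> 0" "c \<ge> 0" "d \<ge> 0" "g \<ge> 0" "f \<ge> 0" unfolding defs using nonneg by auto
  have e: "a = k + s - f" "g = k - s" "d = 2 - k - c"
    using sum16 sum25 sum34 b defs by auto
  have m2': "a * (c + d + g + f) + (c * g + c * f + d * f) = 1 + 2 * k"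
    using m2 b unfolding match2_def defs by (simp add: algebra_simps)
  have m3': "a * (c * g + c * f + d * f) = k"
    using m3 b unfolding match3_def defs by (simp add: algebra_simps)
  have mx: "a * c + a * f + d * f = 1 + s * k" using mixed b unfolding defs by simp
  have sm: "a + (c + d + g + f) = 2 + k" using e by simp
  have k0: "k > 0" using e nn s_bounds by simp
  have "(a - 1)\<^sup>2 * (a - k) = 0" using m2' m3' sm by Groebner_Basis.algebra
  then have "a = 1 \<or> a = k" by auto
  then have a: "a = 1"
  proof
    assume ak: "a = k"
    then have 1: "c * g + c * f + d * f = 1" using m3' k0 by simp
    have 2: "c + d + g + f = 2" using sm ak by simp
    \<comment> \<open>Again a vanishing discriminant, that of the quadratic factor of the path with
      edges 3 to 6.\<close>
    have "((c + d) - (g + f))\<^sup>2 + 4 * (d * g) = 0" using 1 2 by Groebner_Basis.algebra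
    moreover have "d * g \<ge> 0" using nn by simp
    ultimately have "((c + d) - (g + f))\<^sup>2 = 0"
      by (smt (verit) zero_le_power2)
    then have "c + d = g + f" by simp
    then show "a = 1" using 2 e ak by simp
  qed
  have f: "f = k + s - 1" using a e by simp
  have cd: "c + d = 2 - k" using e by simp
  have "c * g + (c + d) * f = k" using m3' a by (simp add: algebra_simps)
  then have cg: "c * g = k - (2 - k) * f" unfolding cd by simp
  have "c * (1 - f) = 1 + s * k - f * (1 + (c + d))" using mx a by (simp add: algebra_simps)
  then have c: "c * (1 - f) = 1 + s * k - f * (3 - k)" unfolding cd by simp
  \<comment> \<open>\<open>c\<close> is eliminated by computing \<open>c * g * (1 - f)\<close> in
    two ways. The resulting equation in \<open>k\<close> and \<open>s\<close> has the known solution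
    \<open>k = 1\<close>, so that a linear factor splits off.\<close>
  have "(k - (2 - k) * f) * (1 - f) = (1 + s * k - f * (3 - k)) * g"
    unfolding cg[symmetric] c[symmetric] by simp
  then have "(k - (2 - k) * (k + s - 1)) * (1 - (k + s - 1))
      = (1 + s * k - (k + s - 1) * (3 - k)) * (k - s)"
    unfolding f \<open>g = k - s\<close> .
  then have "(k - 1) * (2 * k\<^sup>2 + (3 * s - 6) * k + 2 * s) = 0"
    using s_sq by Groebner_Basis.algebra
  moreover have "2 * k\<^sup>2 + (3 * s - 6) * k + 2 * s > 0"
  proof -
    \<comment> \<open>Completing the square. The rest is positive iff \<open>s > 9 / 11\<close>,
      that is, \<open>sqrt 2 > 31 / 22\<close>, a narrow margin that calls for the bound
      1.4091.\<close>
    have "8 * (2 * k\<^sup>2 + (3 * s - 6) * k + 2 * s) = (4 * k + 3 * s - 6)\<^sup>2 + (88 * s - 72)"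
      using s_sq by Groebner_Basis.algebra
    moreover have "88 * s > 72"
    proof -
      have "1.4091 < sqrt 2" by (rule real_less_rsqrt) (simp add: power2_eq_square)
      then show ?thesis unfolding s by simp
    qed
    ultimately show ?thesis by (smt (verit) zero_le_power2)
  qed
  ultimately have k: "k = 1" by simp
  then have fg: "f = s" "g = 1 - s" using f e by auto
  have "c * (1 - s) = 1 - s" using cg k fg by simp
  then have "c = 1" using s_bounds by simp
  then show "\<xi> 1 = 1" "\<xi> 3 = 1" "\<xi> 4 = 0" "\<xi> 5 = 1 - s" "\<xi> 6 = s" "k = 1"
    using defs a k e fg by auto
qed

text \<open>Four cases yield only two tuples, the reversals of each other: each has two interior
  zeros, the first in positions 3 and 5, the second in positions 2 and 4.\<close>

lemma solutions:
  "k = 1 \<and> (map \<xi> [1..<7] = [s, 1 - s, 0, 1, 0, 1] \<or> map \<xi> [1..<7] = [1, 0, 1, 0, 1 - s, s])"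
proof -
  have up: "[1..<7] = [1, 2, 3, 4, 5, 6::nat]" by (simp add: upt_conv_Cons)
  interpret r: xi_equations "\<lambda>j. \<xi> (7 - j)" k s by (rule reversed)
  show ?thesis
    using some_zero
  proof (elim disjE)
    assume "\<xi> 2 = 0" from case_2[OF this] this show ?thesis unfolding up by simp
  next
    assume "\<xi> 3 = 0" from case_3[OF this] this show ?thesis unfolding up by simp
  next
    assume 4: "\<xi> 4 = 0"
    then have "\<xi> (7 - 3) = 0" by simp
    from r.case_3[OF this] 4 show ?thesis unfolding up by simp
  next
    assume 5: "\<xi> 5 = 0"
    then have "\<xi> (7 - 2) = 0" by simp
    from r.case_2[OF this] 5 show ?thesis unfolding up by simp
  qed
qed

end

section \<open>Coefficient comparison\<close>

text \<open>Parity of degrees: a linear polynomial is not the square of a rational function.\<close>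

lemma square_eq_square_times_linear:
  fixes A B l :: "'a::idom poly"
  assumes eq: "A\<^sup>2 = B\<^sup>2 * l" and l: "degree l = 1"
  shows "A = 0 \<and> B = 0"
proof -
  have "B = 0"
  proof (rule ccontr)
    assume B: "B \<noteq> 0"
    have "l \<noteq> 0" using l by auto
    then have "2 * degree A = 2 * degree B + 1"
      using arg_cong[OF eq, of degree] B l by (simp add: degree_mult_eq degree_power_eq power2_eq_square)
        (metis B \<open>l \<noteq> 0\<close> degree_mult_eq eq mult_2 mult_eq_0_iff power2_eq_square)
    then show False by presburger
  qed
  then show ?thesis using eq by simp
qed

lemma poly_eq_0_if_infinite_roots:
  fixes p :: "'a::idom poly"
  assumes "infinite S" "\<And>x. x \<in> S \<Longrightarrow> poly p x = 0"
  shows "p = 0"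
  using assms poly_roots_finite[of p] finite_subset[of S "{x. poly p x = 0}"] by blast

text \<open>\<open>lin2\<close>, \<open>lin3\<close> and \<open>quad3\<close> are the mixed
  coefficients in \<open>match_affine\<close>. An edge is weighted in \<open>lin2\<close> by the
  number of edges disjoint from it, and in \<open>lin3\<close> by the number of 2-matchings disjoint
  from it.\<close>

definition lin2 :: "(nat \<Rightarrow> real) \<Rightarrow> real" where
  "lin2 \<xi> = 4 * (\<xi> 1 + \<xi> 6) + 3 * (\<xi> 2 + \<xi> 3 + \<xi> 4 + \<xi> 5)"

definition lin3 :: "(nat \<Rightarrow> real) \<Rightarrow> real" where
  "lin3 \<xi> = 3 * (\<xi> 1 + \<xi> 6) + (\<xi> 2 + \<xi> 5) + 2 * (\<xi> 3 + \<xi> 4)"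

text \<open>A 2-matching is weighted by the number of its extensions to a 3-matching. This number is
  1 except for \<open>{1, 3}\<close>, \<open>{1, 6}\<close>, \<open>{4, 6}\<close> with two
  extensions and \<open>{2, 5}\<close> with none.\<close>

definition quad3 :: "(nat \<Rightarrow> real) \<Rightarrow> real" where
  "quad3 \<xi> = match2 \<xi> + \<xi> 1 * \<xi> 3 + \<xi> 1 * \<xi> 6 + \<xi> 4 * \<xi> 6 - \<xi> 2 * \<xi> 5"

lemma match_affine:
  fixes \<xi> :: "nat \<Rightarrow> real"
  shows "match1 (\<lambda>j. u + \<xi> j * R) = 6 * u + match1 \<xi> * R"
    and "match2 (\<lambda>j. u + \<xi> j * R) = 10 * u\<^sup>2 + lin2 \<xi> * u * R + match2 \<xi> * R\<^sup>2"
    and "match3 (\<lambda>j. u + \<xi> j * R) = 4 * u ^ 3 + lin3 \<xi> * u\<^sup>2 * R + quad3 \<xi> * u * R\<^sup>2 + match3 \<xi> * R ^ 3"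
  unfolding match_defs lin2_def lin3_def quad3_def by Groebner_Basis.algebra+

text \<open>Multiplying the equation of \<open>E\<close> by its mirror image under
  \<open>m \<mapsto> -m\<close> gives a quadratic in \<open>y = m\<^sup>2\<close>. If its remainder
  \<open>B * y + C\<close> in the cubic vanishes at a common root, then
  \<open>(2 * C + B * M)\<^sup>2\<close> is \<open>B\<^sup>2\<close> times the discriminant.
  Infinitely many \<open>R\<close> turn this into an identity of polynomials in \<open>R\<close>; as
  the discriminant is linear, \<open>B\<close> and \<open>C\<close> vanish.\<close>

lemma common_roots_imp_coeffs:
  fixes \<xi> :: "nat \<Rightarrow> real" and e p X :: real
  assumes e: "e > 0" and p: "p\<^sup>2 = (2 - sqrt 2) / 2" and X: "X\<^sup>2 = (2 + sqrt 2) / 2"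
    and inf: "infinite {R. R > 0 \<and> (\<exists>m. path_poly (\<lambda>j. 1 + \<xi> j * R) m = 0 \<and> (m - p)\<^sup>2 = X\<^sup>2 + e * R)}"
  defines "k \<equiv> match1 \<xi> - 2 * e"
  shows "lin2 \<xi> = 2 * sqrt 2 * e + 4 * k + 4 * e"
    and "match2 \<xi> = e\<^sup>2 + 2 * e * k"
    and "lin3 \<xi> = 4 * sqrt 2 * e + 2 * k"
    and "quad3 \<xi> = 2 * e\<^sup>2 + 2 * sqrt 2 * e * k"
    and "match3 \<xi> = e\<^sup>2 * k"
proof -
  \<comment> \<open>The quadratic is \<open>y\<^sup>2 - M * y + (sqrt 2 + e * R)\<^sup>2\<close>,
    with discriminant \<open>2 * l\<close>; \<open>B * y + C\<close> is the cubic minus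
    \<open>y - (2 + k * R)\<close> times it. \<open>B\<close> and \<open>C\<close> have no constant
    term because the foci are eigenvalues of \<open>A\<close>.\<close>
  define M where "M = [:4, 2 * e:]"
  define l where "l = [:4, 4 * (2 - sqrt 2) * e:]"
  define B where "B = [:0, lin2 \<xi> - (2 * sqrt 2 * e + 4 * k + 4 * e), match2 \<xi> - (e\<^sup>2 + 2 * e * k):]"
  define C where "C = [:0, 4 * sqrt 2 * e + 2 * k - lin3 \<xi>,
    2 * e\<^sup>2 + 2 * sqrt 2 * e * k - quad3 \<xi>, e\<^sup>2 * k - match3 \<xi>:]"
  have sq2: "sqrt 2 * sqrt 2 = (2::real)" by simp
  have "(2 * C + B * M)\<^sup>2 - B\<^sup>2 * smult 2 l = 0"
  proof (rule poly_eq_0_if_infinite_roots[OF inf])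
    fix R
    assume "R \<in> {R. R > 0 \<and> (\<exists>m. path_poly (\<lambda>j. 1 + \<xi> j * R) m = 0 \<and> (m - p)\<^sup>2 = X\<^sup>2 + e * R)}"
    then obtain m where R: "R > 0" and root: "path_poly (\<lambda>j. 1 + \<xi> j * R) m = 0"
      and m: "(m - p)\<^sup>2 = X\<^sup>2 + e * R" by auto
    define y where "y = m\<^sup>2"
    have "m\<^sup>2 - sqrt 2 - e * R = 2 * p * m"
      using m p X by (simp add: power2_eq_square algebra_simps)
    then have "(y - sqrt 2 - e * R)\<^sup>2 = 4 * p\<^sup>2 * m\<^sup>2" unfolding y_def by Groebner_Basis.algebra
    also have "\<dots> = (4 - 2 * sqrt 2) * y" unfolding p y_def by simp
    finally have N: "(y - sqrt 2 - e * R)\<^sup>2 = (4 - 2 * sqrt 2) * y" .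
    have "m \<noteq> 0"
    proof
      assume "m = 0"
      then have "sqrt 2 + e * R = 0" using \<open>m\<^sup>2 - sqrt 2 - e * R = 2 * p * m\<close> by simp
      moreover have "sqrt 2 + e * R > 0" using e R by (simp add: add_pos_pos)
      ultimately show False by simp
    qed
    moreover have "m * (y ^ 3 - match1 (\<lambda>j. 1 + \<xi> j * R) * y\<^sup>2
        + match2 (\<lambda>j. 1 + \<xi> j * R) * y - match3 (\<lambda>j. 1 + \<xi> j * R)) = 0"
      using root unfolding path_poly_def y_def by (simp add: algebra_simps eval_nat_numeral)
    ultimately have G: "y ^ 3 - (6 + match1 \<xi> * R) * y\<^sup>2 + (10 + lin2 \<xi> * R + match2 \<xi> * R\<^sup>2) * y
        - (4 + lin3 \<xi> * R + quad3 \<xi> * R\<^sup>2 + match3 \<xi> * R ^ 3) = 0"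
      using match_affine[of 1 \<xi> R] by simp
    have "poly M R = 4 + 2 * e * R" unfolding M_def by (simp add: algebra_simps)
    moreover have "poly (smult 2 l) R = (4 + 2 * e * R)\<^sup>2 - 4 * (sqrt 2 + e * R)\<^sup>2"
      unfolding l_def using sq2 by (simp add: power2_eq_square algebra_simps)
    moreover have "poly B R * y + poly C R = 0"
    proof -
      have "poly B R = (10 + lin2 \<xi> * R + match2 \<xi> * R\<^sup>2) - (sqrt 2 + e * R)\<^sup>2 - (2 + k * R) * (4 + 2 * e * R)"
        unfolding B_def using sq2 by (simp add: power2_eq_square algebra_simps)
      moreover have "poly C R = (2 + k * R) * (sqrt 2 + e * R)\<^sup>2
          - (4 + lin3 \<xi> * R + quad3 \<xi> * R\<^sup>2 + match3 \<xi> * R ^ 3)"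
        unfolding C_def using sq2 by (simp add: power2_eq_square power3_eq_cube algebra_simps)
      moreover have "match1 \<xi> = k + 2 * e" unfolding k_def by simp
      moreover have "y\<^sup>2 = (4 + 2 * e * R) * y - (sqrt 2 + e * R)\<^sup>2"
        using N by (simp add: power2_eq_square algebra_simps)
      ultimately show ?thesis using G by Groebner_Basis.algebra
    qed
    moreover have "y\<^sup>2 = (4 + 2 * e * R) * y - (sqrt 2 + e * R)\<^sup>2"
      using N by (simp add: power2_eq_square algebra_simps)
    ultimately show "poly ((2 * C + B * M)\<^sup>2 - B\<^sup>2 * smult 2 l) R = 0"
      by simp Groebner_Basis.algebra
  qed
  then have "(2 * C + B * M)\<^sup>2 = B\<^sup>2 * smult 2 l" by simp
  moreover have "sqrt 2 \<noteq> (2::real)" by (simp add: real_sqrt_eq_iff[of 2 4, simplified])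
  then have "degree (smult 2 l) = 1" unfolding l_def using e by simp
  ultimately have "2 * C + B * M = 0 \<and> B = 0" by (rule square_eq_square_times_linear)
  then have "B = 0" "C = 0" by auto
  then show "lin2 \<xi> = 2 * sqrt 2 * e + 4 * k + 4 * e"
    and "match2 \<xi> = e\<^sup>2 + 2 * e * k"
    and "lin3 \<xi> = 4 * sqrt 2 * e + 2 * k"
    and "quad3 \<xi> = 2 * e\<^sup>2 + 2 * sqrt 2 * e * k"
    and "match3 \<xi> = e\<^sup>2 * k"
    unfolding B_def C_def by simp_all
qed

text \<open>All equations are homogeneous in \<open>\<xi>\<close>, \<open>k\<close> and
  \<open>e\<close>, so dividing by \<open>e\<close> reduces them to minor half-axis 1.\<close>

lemma coeffs_imp_xi:
  fixes \<xi> :: "nat \<Rightarrow> real" and e k :: real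
  assumes e: "e > 0" and nn: "\<And>j. \<xi> j \<ge> 0"
    and "match1 \<xi> = 2 * e + k"
    and "lin2 \<xi> = 2 * sqrt 2 * e + 4 * k + 4 * e"
    and "match2 \<xi> = e\<^sup>2 + 2 * e * k"
    and "lin3 \<xi> = 4 * sqrt 2 * e + 2 * k"
    and "quad3 \<xi> = 2 * e\<^sup>2 + 2 * sqrt 2 * e * k"
    and "match3 \<xi> = e\<^sup>2 * k"
  shows "map \<xi> [1..<7] = map ((*) e) [2 * sqrt 2 - 2, 3 - 2 * sqrt 2, 0, 1, 0, 1] \<or>
         map \<xi> [1..<7] = map ((*) e) [1, 0, 1, 0, 3 - 2 * sqrt 2, 2 * sqrt 2 - 2]"
proof -
  define \<eta> where "\<eta> j = \<xi> j / e" for j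
  define l where "l = k / e"
  have \<xi>: "\<xi> j = e * \<eta> j" for j using e by (simp add: \<eta>_def)
  have k: "k = e * l" using e by (simp add: l_def)
  have \<xi>': "\<xi> = (\<lambda>j. e * \<eta> j)" using \<xi> by auto
  have hom: "match1 \<xi> = e * match1 \<eta>" "lin2 \<xi> = e * lin2 \<eta>" "match2 \<xi> = e\<^sup>2 * match2 \<eta>"
     "lin3 \<xi> = e * lin3 \<eta>" "quad3 \<xi> = e\<^sup>2 * quad3 \<eta>" "match3 \<xi> = e ^ 3 * match3 \<eta>"
    unfolding match_defs lin2_def lin3_def quad3_def \<xi>' by (simp_all add: algebra_simps power2_eq_square power3_eq_cube)
  have "e * match1 \<eta> = e * (2 + l)" "e * lin2 \<eta> = e * (2 * sqrt 2 + 4 * l + 4)"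
    "e\<^sup>2 * match2 \<eta> = e\<^sup>2 * (1 + 2 * l)" "e * lin3 \<eta> = e * (4 * sqrt 2 + 2 * l)"
    "e\<^sup>2 * quad3 \<eta> = e\<^sup>2 * (2 + 2 * sqrt 2 * l)" "e ^ 3 * match3 \<eta> = e ^ 3 * l"
    using assms unfolding hom[symmetric] k by (simp_all add: algebra_simps power2_eq_square power3_eq_cube)
  then have eqs: "match1 \<eta> = 2 + l" "lin2 \<eta> = 2 * sqrt 2 + 4 * l + 4"
    "match2 \<eta> = 1 + 2 * l" "lin3 \<eta> = 4 * sqrt 2 + 2 * l"
    "quad3 \<eta> = 2 + 2 * sqrt 2 * l" "match3 \<eta> = l"
    using e by auto
  interpret xi_equations \<eta> l "2 * sqrt 2 - 2"
  proof
    show "\<eta> j \<ge> 0" for j using nn e by (simp add: \<eta>_def)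
    \<comment> \<open>The linear coefficients depend only on the sums of mirror-image weights; the
      three equations determine these sums.\<close>
    show "\<eta> 1 + \<eta> 6 = l + (2 * sqrt 2 - 2)" "\<eta> 2 + \<eta> 5 = l - (2 * sqrt 2 - 2)" "\<eta> 3 + \<eta> 4 = 2 - l"
      using eqs(1,2,4) unfolding match1_def lin2_def lin3_def by (simp_all add: algebra_simps)
    show "\<eta> 1 * \<eta> 3 + \<eta> 1 * \<eta> 6 + \<eta> 4 * \<eta> 6 - \<eta> 2 * \<eta> 5 = 1 + (2 * sqrt 2 - 2) * l"
      using eqs(3,5) unfolding quad3_def by (simp add: algebra_simps)
  qed (use eqs in simp_all)
  have eq: "map \<xi> [1..<7] = map ((*) e) (map \<eta> [1..<7])"
    unfolding \<xi>' by (simp add: comp_def)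
  have "map \<eta> [1..<7] = [2 * sqrt 2 - 2, 3 - 2 * sqrt 2, 0, 1, 0, 1] \<or>
      map \<eta> [1..<7] = [1, 0, 1, 0, 3 - 2 * sqrt 2, 2 * sqrt 2 - 2]"
    using solutions by simp
  then show ?thesis unfolding eq by (rule disj_forward) (simp_all only:)
qed

section \<open>The Kippenhahn polynomial of a reciprocal matrix\<close>

definition tridiag :: "(nat \<Rightarrow> 'a) \<Rightarrow> (nat \<Rightarrow> 'a) \<Rightarrow> (nat \<Rightarrow> 'a) \<Rightarrow> nat \<Rightarrow> 'a::comm_ring_1 mat" where
  "tridiag a b c n = Matrix.mat n n (\<lambda>(i, j). if i = j then a i else if j = Suc i then b i
     else if i = Suc j then c j else 0)"

lemma tridiag_carrier [simp]: "tridiag a b c n \<in> carrier_mat n n"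
  by (simp add: tridiag_def)

lemma det_tridiag_0: "Determinant.det (tridiag a b c 0) = 1"
  by simp

lemma det_tridiag_1: "Determinant.det (tridiag a b c (Suc 0)) = a 0"
  by (subst det_single) (auto simp: tridiag_def)

text \<open>The continuant recurrence: expansion along the last row, and then of the minor
  \<open>N\<close> along its last column, whose only possibly nonzero entry is
  \<open>b n\<close>.\<close>

lemma det_tridiag_Suc_Suc:
  "Determinant.det (tridiag a b c (Suc (Suc n))) =
     a (Suc n) * Determinant.det (tridiag a b c (Suc n)) - b n * c n * Determinant.det (tridiag a b c n)"
proof -
  define T where "T = tridiag a b c (Suc (Suc n))"
  have T: "T \<in> carrier_mat (Suc (Suc n)) (Suc (Suc n))" by (simp add: T_def)
  define N where "N = mat_delete T (Suc n) n"
  have N: "N \<in> carrier_mat (Suc n) (Suc n)" using T unfolding N_def by (auto simp: mat_delete_def)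
  have del1: "mat_delete T (Suc n) (Suc n) = tridiag a b c (Suc n)"
    by (rule eq_matI) (auto simp: T_def mat_delete_def tridiag_def)
  have del2: "mat_delete N n n = tridiag a b c n"
    by (rule eq_matI) (auto simp: N_def T_def mat_delete_def tridiag_def)
  have N_last: "N $$ (i, n) = (if i = n then b n else 0)" if "i < Suc n" for i
    using that by (auto simp: N_def T_def mat_delete_def tridiag_def)
  have "Determinant.det N = (\<Sum>i<Suc n. N $$ (i, n) * cofactor N i n)"
    using laplace_expansion_column[OF N, of n] by simp
  also have "\<dots> = b n * cofactor N n n"
    by (simp add: N_last)
  finally have detN: "Determinant.det N = b n * Determinant.det (tridiag a b c n)"
    by (simp add: cofactor_def del2)
  have "Determinant.det T = (\<Sum>j<Suc (Suc n). T $$ (Suc n, j) * cofactor T (Suc n) j)"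
    using laplace_expansion_row[OF T, of "Suc n"] by simp
  also have "\<dots> = T $$ (Suc n, n) * cofactor T (Suc n) n + T $$ (Suc n, Suc n) * cofactor T (Suc n) (Suc n)"
  proof -
    have "(\<Sum>j<n. T $$ (Suc n, j) * cofactor T (Suc n) j) = 0"
      by (rule sum.neutral) (auto simp: T_def tridiag_def)
    then show ?thesis by simp
  qed
  also have "\<dots> = a (Suc n) * Determinant.det (tridiag a b c (Suc n)) - b n * c n * Determinant.det (tridiag a b c n)"
    by (simp add: cofactor_def del1 N_def[symmetric] detN) (simp add: T_def tridiag_def)
  finally show ?thesis by (simp add: T_def)
qed

lemma det_tridiag_7:
  "Determinant.det (tridiag (\<lambda>_. - x) b c 7) = - path_poly (\<lambda>j. b (j - 1) * c (j - 1)) x"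
proof -
  have 7: "7 = Suc (Suc (Suc (Suc (Suc (Suc (Suc 0))))))" by simp
  show ?thesis
    unfolding 7 det_tridiag_Suc_Suc det_tridiag_0 det_tridiag_1 path_poly_def match_defs
    by (simp add: eval_nat_numeral algebra_simps)
qed

lemma path_poly_cong:
  assumes "\<And>j. j \<in> {1..6} \<Longrightarrow> v j = w j"
  shows "path_poly v x = path_poly w x"
proof -
  have "v 1 = w 1" "v 2 = w 2" "v 3 = w 3" "v 4 = w 4" "v 5 = w 5" "v 6 = w 6"
    using assms by simp_all
  then show ?thesis unfolding path_poly_def match_defs by simp
qed

text \<open>With \<open>u * v = 1\<close>, the cross terms of four times a squared off-diagonal
  modulus add up to \<open>4 * (cos \<theta>)\<^sup>2 - 2\<close>, while
  \<open>(cmod u)\<^sup>2 + (cmod v)\<^sup>2\<close> is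
  \<open>(cmod u - cmod v)\<^sup>2 + 2\<close>. The constants cancel.\<close>

lemma kippenhahn_poly_reciprocal:
  assumes A: "A \<in> reciprocal_mats 7"
  shows "kippenhahn_poly A x \<theta> = - path_poly (\<lambda>j. complex_of_real ((cos \<theta>)\<^sup>2 + xi A j)) x"
proof -
  from A have carr: "A \<in> carrier_mat 7 7"
    and band: "\<And>i j. i < 7 \<Longrightarrow> j < 7 \<Longrightarrow> i + 1 < j \<or> j + 1 < i \<Longrightarrow> A $$ (i, j) = 0"
    and diag: "\<And>i. i < 7 \<Longrightarrow> A $$ (i, i) = 0"
    and recip: "\<And>i. i + 1 < 7 \<Longrightarrow> A $$ (i, i + 1) * A $$ (i + 1, i) = 1"
    unfolding reciprocal_mats_def by auto
  define b where "b i = (cis \<theta> * A $$ (i, Suc i) + cnj (cis \<theta> * A $$ (Suc i, i))) / 2" for i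
  define c where "c i = (cis \<theta> * A $$ (Suc i, i) + cnj (cis \<theta> * A $$ (i, Suc i))) / 2" for i
  have adj: "mat_adjoint B $$ (i, j) = cnj (B $$ (j, i))" if "B \<in> carrier_mat 7 7" "i < 7" "j < 7" for B :: "complex mat" and i j
    using that unfolding mat_adjoint_def by (simp add: mat_of_rows_index)
  have adj_carr: "mat_adjoint B \<in> carrier_mat 7 7" if "B \<in> carrier_mat 7 7" for B :: "complex mat"
    using that unfolding mat_adjoint_def by auto
  have re: "re_mat (cis \<theta> \<cdot>\<^sub>m A) \<in> carrier_mat 7 7"
    unfolding re_mat_def using carr adj_carr[of "cis \<theta> \<cdot>\<^sub>m A"] by simp
  have re_ix: "re_mat (cis \<theta> \<cdot>\<^sub>m A) $$ (i, j) = (cis \<theta> * A $$ (i, j) + cnj (cis \<theta> * A $$ (j, i))) / 2"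
    if "i < 7" "j < 7" for i j
    using that carr adj_carr[of "cis \<theta> \<cdot>\<^sub>m A"] unfolding re_mat_def
    by (simp add: adj carrier_matD[OF carr] carrier_matD[OF adj_carr[of "cis \<theta> \<cdot>\<^sub>m A"]])
  have "re_mat (cis \<theta> \<cdot>\<^sub>m A) - x \<cdot>\<^sub>m (1\<^sub>m (dim_row A)) = tridiag (\<lambda>_. - x) b c 7"
  proof (rule eq_matI)
    fix i j assume "i < dim_row (tridiag (\<lambda>_. - x) b c 7)" "j < dim_col (tridiag (\<lambda>_. - x) b c 7)"
    then have ij: "i < 7" "j < 7" by (simp_all add: tridiag_def)
    have "i + 1 < j \<or> j + 1 < i \<or> i = j \<or> j = Suc i \<or> i = Suc j" by linarith
    then show "(re_mat (cis \<theta> \<cdot>\<^sub>m A) - x \<cdot>\<^sub>m (1\<^sub>m (dim_row A))) $$ (i, j) = tridiag (\<lambda>_. - x) b c 7 $$ (i, j)"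
      using ij carr re band[of i j] band[of j i] diag[of i]
      by (auto simp: re_ix tridiag_def b_def c_def)
  qed (use carr re in \<open>auto simp: tridiag_def\<close>)
  then have "kippenhahn_poly A x \<theta> = - path_poly (\<lambda>j. b (j - 1) * c (j - 1)) x"
    unfolding kippenhahn_poly_def by (simp add: det_tridiag_7)
  moreover have "b (j - 1) * c (j - 1) = complex_of_real ((cos \<theta>)\<^sup>2 + xi A j)" if "j \<in> {1..6}" for j
  proof -
    define u v where "u = A $$ (j - 1, j)" and "v = A $$ (j, j - 1)"
    have j: "Suc (j - 1) = j" using that by simp
    have uv: "u * v = 1" using recip[of "j - 1"] that j unfolding u_def v_def by auto
    then have muv: "cmod u * cmod v = 1" by (metis norm_mult norm_one)
    have "4 * (b (j - 1) * c (j - 1)) =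
        (cis \<theta> * u + cnj (cis \<theta> * v)) * (cis \<theta> * v + cnj (cis \<theta> * u))"
      unfolding b_def c_def j u_def v_def by simp
    also have "\<dots> = (cis \<theta>)\<^sup>2 * (u * v) + (cis \<theta> * cnj (cis \<theta>)) * (u * cnj u)
        + (cis \<theta> * cnj (cis \<theta>)) * (v * cnj v) + (cnj (cis \<theta>))\<^sup>2 * cnj (u * v)"
      by (simp add: power2_eq_square algebra_simps)
    also have "\<dots> = ((cis \<theta>)\<^sup>2 + (cnj (cis \<theta>))\<^sup>2) + complex_of_real ((cmod u)\<^sup>2 + (cmod v)\<^sup>2)"
      by (simp add: uv complex_norm_square[symmetric] cis_cnj cis_mult)
    also have "(cis \<theta>)\<^sup>2 + (cnj (cis \<theta>))\<^sup>2 = complex_of_real (4 * (cos \<theta>)\<^sup>2 - 2)"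
    proof (rule complex_eqI)
      have "(sin \<theta>)\<^sup>2 = 1 - (cos \<theta>)\<^sup>2" by (simp add: sin_squared_eq)
      then show "Re ((cis \<theta>)\<^sup>2 + (cnj (cis \<theta>))\<^sup>2) = Re (complex_of_real (4 * (cos \<theta>)\<^sup>2 - 2))"
        by (simp add: power2_eq_square)
    qed (simp add: power2_eq_square)
    also have "complex_of_real (4 * (cos \<theta>)\<^sup>2 - 2) + complex_of_real ((cmod u)\<^sup>2 + (cmod v)\<^sup>2) =
        complex_of_real (4 * ((cos \<theta>)\<^sup>2 + (cmod u - cmod v)\<^sup>2 / 4))"
    proof -
      have "(cmod u - cmod v)\<^sup>2 = (cmod u)\<^sup>2 + (cmod v)\<^sup>2 - 2"
        using muv by (simp add: power2_diff mult.assoc)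
      then show ?thesis by simp
    qed
    finally have "4 * (b (j - 1) * c (j - 1)) =
        4 * complex_of_real ((cos \<theta>)\<^sup>2 + (cmod u - cmod v)\<^sup>2 / 4)"
      by (simp only: of_real_mult of_real_numeral)
    then have "b (j - 1) * c (j - 1) = complex_of_real ((cos \<theta>)\<^sup>2 + (cmod u - cmod v)\<^sup>2 / 4)"
      by (simp only: mult_cancel_left) simp
    then show ?thesis unfolding xi_def u_def v_def .
  qed
  then have "path_poly (\<lambda>j. b (j - 1) * c (j - 1)) x = path_poly (\<lambda>j. complex_of_real ((cos \<theta>)\<^sup>2 + xi A j)) x"
    by (rule path_poly_cong)
  ultimately show ?thesis by simp
qed

lemma path_poly_of_real:
  "path_poly (\<lambda>j. complex_of_real (w j)) (complex_of_real x) = complex_of_real (path_poly w x)"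
  unfolding path_poly_def match_defs by simp

section \<open>Envelopes and tangents of an ellipse\<close>

text \<open>Sard's theorem in dimension one. \<open>S\<close> is an arbitrary set, since the
  parameter sets in question arise from choices without any regularity. \<open>real ^ 1\<close> is
  the setting of \<open>baby_Sard\<close>, where the zero derivative has rank 0 < 1.\<close>

lemma negligible_image_zero_derivative:
  fixes f :: "real \<Rightarrow> real"
  assumes "\<And>x. x \<in> S \<Longrightarrow> (f has_real_derivative 0) (at x within S)"
  shows "negligible ((\<lambda>x. Finite_Cartesian_Product.vec (f x) :: real ^ 1) ` S)"
proof -
  define S' where "S' = {v :: real ^ 1. vec_nth v 1 \<in> S}"
  define F where "F v = (Finite_Cartesian_Product.vec (f (vec_nth v 1)) :: real ^ 1)" for v :: "real ^ 1"
  have "negligible (F ` S')"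
  proof (rule baby_Sard)
    fix v assume v: "v \<in> S'"
    have "((\<lambda>v::real^1. vec_nth v 1) has_derivative (\<lambda>v. vec_nth v 1)) (at v within S')"
      by (rule bounded_linear_imp_has_derivative) (rule bounded_linear_vec_nth)
    moreover have "(f has_derivative (\<lambda>h. 0)) (at (vec_nth v 1) within (\<lambda>v. vec_nth v 1) ` S')"
    proof -
      have "(f has_derivative (\<lambda>h. 0 * h)) (at (vec_nth v 1) within S)"
        using assms[of "vec_nth v 1"] v by (simp only: S'_def has_field_derivative_def mem_Collect_eq)
      then have "(f has_derivative (\<lambda>h. 0)) (at (vec_nth v 1) within S)"
        by (simp only: mult_zero_left)
      then show ?thesis
        by (rule has_derivative_subset) (auto simp: S'_def)
    qed
    ultimately have "((\<lambda>v. f (vec_nth v 1)) has_derivative (\<lambda>h. 0)) (at v within S')"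
      by (rule has_derivative_in_compose)
    then show "(F has_derivative (\<lambda>h. 0)) (at v within S')"
      unfolding F_def by (subst has_derivative_componentwise_within)
        (auto simp: Basis_vec_def axis_def inner_vec_def)
    show "rank (matrix (\<lambda>h :: real^1. 0 :: real^1)) < CARD(1)"
      by (simp add: matrix_def rank_0 zero_vec_def[symmetric])
  qed simp
  moreover have "F ` S' = (\<lambda>x. Finite_Cartesian_Product.vec (f x)) ` S"
    unfolding F_def S'_def by (force intro!: image_eqI[where x = "Finite_Cartesian_Product.vec _"])
  ultimately show ?thesis by simp
qed

lemma interval_not_covered:
  fixes f :: "'i \<Rightarrow> real \<Rightarrow> real"
  assumes "a < b" "countable C" "countable I"
    and "\<And>i x. i \<in> I \<Longrightarrow> x \<in> S i \<Longrightarrow> (f i has_real_derivative 0) (at x within S i)"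
  shows "\<not> {a<..<b} \<subseteq> C \<union> (\<Union>i\<in>I. f i ` S i)"
proof
  assume sub: "{a<..<b} \<subseteq> C \<union> (\<Union>i\<in>I. f i ` S i)"
  let ?v = "Finite_Cartesian_Product.vec :: real \<Rightarrow> real ^ 1"
  have "box (?v a) (?v b) \<subseteq> ?v ` (C \<union> (\<Union>i\<in>I. f i ` S i))"
  proof
    fix v assume "v \<in> box (?v a) (?v b)"
    then have "vec_nth v 1 \<in> {a<..<b}" by (simp add: mem_box_cart)
    with sub have "vec_nth v 1 \<in> C \<union> (\<Union>i\<in>I. f i ` S i)" by (rule subsetD)
    moreover have "v = ?v (vec_nth v 1)" by (simp add: vec_eq_iff)
    ultimately show "v \<in> ?v ` (C \<union> (\<Union>i\<in>I. f i ` S i))" by (rule rev_image_eqI)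
  qed
  then have "box (?v a) (?v b) \<subseteq> ?v ` C \<union> (\<Union>i\<in>I. (\<lambda>x. ?v (f i x)) ` S i)"
    by (simp add: image_Un image_UN image_image)
  moreover have "negligible (\<Union>x\<in>C. {?v x})"
    using assms by (intro negligible_countable_Union) auto
  then have "negligible (?v ` C)" by (simp add: UNION_singleton_eq_range)
  moreover have "negligible (\<Union>i\<in>I. (\<lambda>x. ?v (f i x)) ` S i)"
  proof (rule negligible_countable_Union)
    show "countable ((\<lambda>i. (\<lambda>x. ?v (f i x)) ` S i) ` I)" using assms by simp
    show "negligible V" if "V \<in> (\<lambda>i. (\<lambda>x. ?v (f i x)) ` S i) ` I" for V
      using that assms(4) negligible_image_zero_derivative by blast
  qed
  ultimately have "negligible (box (?v a) (?v b))"
    by (meson negligible_Un negligible_subset)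
  moreover have "?v ((a + b) / 2) \<in> box (?v a) (?v b)" using \<open>a < b\<close> by (simp add: mem_box_cart)
  ultimately show False using negligible_interval(2) by blast
qed

section \<open>Differentiable selections from a plane zero set\<close>

lemma MVT_abs:
  fixes f :: "real \<Rightarrow> real"
  assumes "\<And>x. (f has_real_derivative f' x) (at x)"
  shows "\<exists>z. \<bar>z - a\<bar> \<le> \<bar>b - a\<bar> \<and> f b - f a = f' z * (b - a)"
proof (cases a b rule: linorder_cases)
  case less
  then obtain z where "a < z" "z < b" "f b - f a = (b - a) * f' z"
    using MVT2[of a b f f'] assms by blast
  then show ?thesis by (intro exI[of _ z]) auto
next
  case greater
  then obtain z where "b < z" "z < a" "f a - f b = (a - b) * f' z"
    using MVT2[of b a f f'] assms by blast
  then show ?thesis by (intro exI[of _ z]) (auto simp: algebra_simps)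
qed auto

lemma differentiable_along_graph:
  fixes u :: "real \<Rightarrow> real" and h :: "real \<Rightarrow> real \<Rightarrow> real"
  assumes h: "\<And>p. (\<lambda>p. h (fst p) (snd p)) differentiable (at p)"
    and u: "u differentiable (at x within S)"
  shows "(\<lambda>r. h (u r) r) differentiable (at x within S)"
proof -
  obtain u' where "(u has_derivative u') (at x within S)" using u differentiable_def by blast
  then have "((\<lambda>r. (u r, r)) has_derivative (\<lambda>t. (u' t, t))) (at x within S)"
    by (intro has_derivative_Pair has_derivative_ident)
  moreover obtain h' where "((\<lambda>p. h (fst p) (snd p)) has_derivative h') (at (u x, x))"
    using h differentiable_def by blast
  ultimately have "((\<lambda>r. h (fst (u r, r)) (snd (u r, r))) has_derivative (\<lambda>t. h' (u' t, t))) (at x within S)"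
    by (rule has_derivative_compose)
  then show ?thesis unfolding differentiable_def by auto
qed

text \<open>Differentiability of the partial derivatives is assumed in order that
  \<open>gr / gm\<close>, the height of the touching point, can itself be differentiated along the
  zero set.\<close>

locale implicit_curve =
  fixes g gm gr :: "real \<Rightarrow> real \<Rightarrow> real"
  assumes deriv_m: "((\<lambda>m. g m r) has_real_derivative gm m r) (at m)"
    and deriv_r: "(g m has_real_derivative gr m r) (at r)"
    and diff_gm: "(\<lambda>p. gm (fst p) (snd p)) differentiable (at p)"
    and diff_gr: "(\<lambda>p. gr (fst p) (snd p)) differentiable (at p)"
begin

lemma tendsto_gm: "((\<lambda>x. gm (u x) (v x)) \<longlongrightarrow> gm m r) F"
  if "(u \<longlongrightarrow> m) F" "(v \<longlongrightarrow> r) F"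
proof -
  have "isCont (\<lambda>p. gm (fst p) (snd p)) (m, r)" by (intro differentiable_imp_continuous_within diff_gm)
  from isCont_tendsto_compose[OF this tendsto_Pair[OF that]] show ?thesis by simp
qed

lemma tendsto_gr: "((\<lambda>x. gr (u x) (v x)) \<longlongrightarrow> gr m r) F"
  if "(u \<longlongrightarrow> m) F" "(v \<longlongrightarrow> r) F"
proof -
  have "isCont (\<lambda>p. gr (fst p) (snd p)) (m, r)" by (intro differentiable_imp_continuous_within diff_gr)
  from isCont_tendsto_compose[OF this tendsto_Pair[OF that]] show ?thesis by simp
qed

text \<open>The mean value theorem on both legs of the path from \<open>(m, r)\<close> over
  \<open>(m, r')\<close> to \<open>(m', r')\<close>.\<close>

lemma zero_difference:
  assumes "g m r = 0" "g m' r' = 0"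
  shows "\<exists>z z'. \<bar>z - m\<bar> \<le> \<bar>m' - m\<bar> \<and> \<bar>z' - r\<bar> \<le> \<bar>r' - r\<bar> \<and>
    gm z r' * (m' - m) + gr m z' * (r' - r) = 0"
proof -
  obtain z where "\<bar>z - m\<bar> \<le> \<bar>m' - m\<bar>" "g m' r' - g m r' = gm z r' * (m' - m)"
    using MVT_abs[of "\<lambda>m. g m r'" "\<lambda>m. gm m r'" m m'] deriv_m by blast
  moreover obtain z' where "\<bar>z' - r\<bar> \<le> \<bar>r' - r\<bar>" "g m r' - g m r = gr m z' * (r' - r)"
    using MVT_abs[of "g m" "gr m" r r'] deriv_r by blast
  ultimately show ?thesis using assms by (intro exI[of _ z] exI[of _ z']) auto
qed

text \<open>The uniqueness half of the implicit function theorem: within \<open>U\<close> the zero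
  set is a Lipschitz graph over its projection. In particular, \<open>r\<close> determines
  \<open>m\<close> there.\<close>

lemma zero_set_lipschitz:
  assumes nz: "gm m0 r0 \<noteq> 0"
  shows "\<exists>U L. open U \<and> (m0, r0) \<in> U \<and> (\<forall>m r m' r'. (m, r) \<in> U \<longrightarrow> (m', r') \<in> U \<longrightarrow>
    g m r = 0 \<longrightarrow> g m' r' = 0 \<longrightarrow> \<bar>m' - m\<bar> \<le> L * \<bar>r' - r\<bar>)"
proof -
  define \<delta> where "\<delta> = \<bar>gm m0 r0\<bar> / 2"
  have \<delta>: "\<delta> > 0" using nz by (simp add: \<delta>_def)
  have f: "((\<lambda>p. fst p :: real) \<longlongrightarrow> m0) (nhds (m0, r0))" "((\<lambda>p. snd p :: real) \<longlongrightarrow> r0) (nhds (m0, r0))"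
    using tendsto_fst[of "\<lambda>p. p" "(m0, r0)"] tendsto_snd[of "\<lambda>p. p" "(m0, r0)"] filterlim_ident
    by (auto simp: filterlim_def)
  have "\<forall>\<^sub>F p in nhds (m0, r0). \<bar>gm (fst p) (snd p) - gm m0 r0\<bar> < \<delta> \<and> \<bar>gr (fst p) (snd p) - gr m0 r0\<bar> < 1"
    using tendstoD[OF tendsto_gm[OF f] \<delta>] tendstoD[OF tendsto_gr[OF f] less_numeral_extra(1)]
    by eventually_elim (simp add: dist_real_def)
  then obtain W where W: "open W" "(m0, r0) \<in> W"
    and close: "\<And>m r. (m, r) \<in> W \<Longrightarrow> \<bar>gm m r - gm m0 r0\<bar> < \<delta> \<and> \<bar>gr m r - gr m0 r0\<bar> < 1"
    unfolding eventually_nhds by fastforce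
  obtain A B where AB: "open A" "open B" "m0 \<in> A" "r0 \<in> B" "A \<times> B \<subseteq> W"
    by (rule open_prod_elim[OF W]) auto
  obtain d where d: "d > 0" "ball m0 d \<subseteq> A" using AB openE by metis
  obtain e where e: "e > 0" "ball r0 e \<subseteq> B" using AB openE by metis
  \<comment> \<open>A third of the radius, so that the intermediate points of the mean value theorem stay in the box.\<close>
  define U where "U = ball m0 (d / 3) \<times> ball r0 (e / 3)"
  have "\<bar>m' - m\<bar> \<le> (\<bar>gr m0 r0\<bar> + 1) / \<delta> * \<bar>r' - r\<bar>"
    if U: "(m, r) \<in> U" "(m', r') \<in> U" and zero: "g m r = 0" "g m' r' = 0" for m r m' r'
  proof -
    obtain z z' where z: "\<bar>z - m\<bar> \<le> \<bar>m' - m\<bar>" "\<bar>z' - r\<bar> \<le> \<bar>r' - r\<bar>"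
      and eq: "gm z r' * (m' - m) + gr m z' * (r' - r) = 0"
      using zero_difference[OF zero] by blast
    have b: "\<bar>m - m0\<bar> < d / 3" "\<bar>m' - m0\<bar> < d / 3" "\<bar>r - r0\<bar> < e / 3" "\<bar>r' - r0\<bar> < e / 3"
      using U by (auto simp: U_def dist_real_def abs_minus_commute)
    have b': "\<bar>z - m0\<bar> < d" using b(1,2) z(1) by linarith
    have b'': "\<bar>z' - r0\<bar> < e" using b(3,4) z(2) by linarith
    have "(z, r') \<in> A \<times> B" "(m, z') \<in> A \<times> B"
      using d(1) e(1) b b' b''
      by (auto simp: dist_real_def abs_minus_commute intro!: subsetD[OF d(2)] subsetD[OF e(2)])
    then have "\<bar>gm z r' - gm m0 r0\<bar> < \<delta>" "\<bar>gr m z' - gr m0 r0\<bar> < 1"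
      using close AB by blast+
    then have 1: "\<bar>gm z r'\<bar> \<ge> \<delta>" and 2: "\<bar>gr m z'\<bar> \<le> \<bar>gr m0 r0\<bar> + 1" unfolding \<delta>_def by linarith+
    have "\<bar>gm z r'\<bar> * \<bar>m' - m\<bar> = \<bar>gr m z'\<bar> * \<bar>r' - r\<bar>"
      using eq by (metis abs_minus_cancel abs_mult add.inverse_unique)
    moreover have "\<delta> * \<bar>m' - m\<bar> \<le> \<bar>gm z r'\<bar> * \<bar>m' - m\<bar>" by (rule mult_right_mono[OF 1]) simp
    moreover have "\<bar>gr m z'\<bar> * \<bar>r' - r\<bar> \<le> (\<bar>gr m0 r0\<bar> + 1) * \<bar>r' - r\<bar>" by (rule mult_right_mono[OF 2]) simp
    ultimately show ?thesis using \<delta> by (simp add: field_simps)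
  qed
  moreover have "open U" "(m0, r0) \<in> U" unfolding U_def using d e by (auto intro: open_Times)
  ultimately show ?thesis by blast
qed

text \<open>Implicit differentiation on an arbitrary set of parameters: the Lipschitz bound pulls
  the intermediate points of the mean value theorem to the base point, so that the difference
  quotients converge.\<close>

lemma zero_set_deriv:
  assumes zero: "\<And>r. r \<in> S \<Longrightarrow> g (m r) r = 0" and r0: "r0 \<in> S"
    and nz: "gm (m r0) r0 \<noteq> 0"
    and lip: "\<And>r. r \<in> S \<Longrightarrow> \<bar>m r - m r0\<bar> \<le> L * \<bar>r - r0\<bar>"
  shows "(m has_real_derivative - (gr (m r0) r0 / gm (m r0) r0)) (at r0 within S)"
proof -
  have "\<forall>r\<in>S. \<exists>z z'. \<bar>z - m r0\<bar> \<le> \<bar>m r - m r0\<bar> \<and> \<bar>z' - r0\<bar> \<le> \<bar>r - r0\<bar> \<and>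
    gm z r * (m r - m r0) + gr (m r0) z' * (r - r0) = 0"
    using zero_difference zero r0 by blast
  then obtain z z' where z: "\<And>r. r \<in> S \<Longrightarrow> \<bar>z r - m r0\<bar> \<le> \<bar>m r - m r0\<bar>"
    and z': "\<And>r. r \<in> S \<Longrightarrow> \<bar>z' r - r0\<bar> \<le> \<bar>r - r0\<bar>"
    and eq: "\<And>r. r \<in> S \<Longrightarrow> gm (z r) r * (m r - m r0) + gr (m r0) (z' r) * (r - r0) = 0"
    by metis
  let ?F = "at r0 within S"
  have S: "\<forall>\<^sub>F r in ?F. r \<in> S" by (simp add: eventually_at_topological) blast
  have id: "((\<lambda>r. r) \<longlongrightarrow> r0) ?F" by (rule tendsto_ident_at)
  then have zero: "((\<lambda>r. r - r0) \<longlongrightarrow> 0) ?F" by (simp add: LIM_zero_iff)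
  then have "((\<lambda>r. z' r - r0) \<longlongrightarrow> 0) ?F"
    by (rule Lim_transform_bound[rotated]) (use S z' in \<open>auto elim: eventually_mono\<close>)
  then have limz': "(z' \<longlongrightarrow> r0) ?F" by (simp add: LIM_zero_iff)
  have "((\<lambda>r. L * (r - r0)) \<longlongrightarrow> 0) ?F" by (rule tendsto_mult_right_zero[OF zero])
  then have "((\<lambda>r. z r - m r0) \<longlongrightarrow> 0) ?F"
  proof (rule Lim_transform_bound[rotated])
    show "\<forall>\<^sub>F r in ?F. norm (z r - m r0) \<le> norm (L * (r - r0))"
      using S
    proof eventually_elim
      case (elim r)
      have "\<bar>z r - m r0\<bar> \<le> L * \<bar>r - r0\<bar>" using z[OF elim] lip[OF elim] by linarith
      also have "\<dots> \<le> \<bar>L * (r - r0)\<bar>" by (simp add: abs_mult mult_right_mono)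
      finally show ?case by simp
    qed
  qed
  then have limz: "(z \<longlongrightarrow> m r0) ?F" by (simp add: LIM_zero_iff)
  have gm: "((\<lambda>r. gm (z r) r) \<longlongrightarrow> gm (m r0) r0) ?F" by (rule tendsto_gm[OF limz id])
  have gr: "((\<lambda>r. gr (m r0) (z' r)) \<longlongrightarrow> gr (m r0) r0) ?F" by (rule tendsto_gr[OF tendsto_const limz'])
  have ne: "\<forall>\<^sub>F r in ?F. gm (z r) r \<noteq> 0" using tendsto_imp_eventually_ne[OF gm nz] .
  have lim: "((\<lambda>r. - (gr (m r0) (z' r) / gm (z r) r)) \<longlongrightarrow> - (gr (m r0) r0 / gm (m r0) r0)) ?F"
    by (intro tendsto_intros gm gr nz)
  have "\<forall>\<^sub>F r in ?F. r \<noteq> r0" by (simp add: eventually_at_filter)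
  with S ne have "\<forall>\<^sub>F r in ?F. - (gr (m r0) (z' r) / gm (z r) r) = (m r - m r0) / (r - r0)"
    by eventually_elim (use eq in \<open>simp add: field_simps add_eq_0_iff\<close>)
  from Lim_transform_eventually[OF lim this] show ?thesis
    by (simp add: has_field_derivative_iff)
qed

text \<open>In the coordinates \<open>(x, y)\<close>, the line \<open>x - r * y = m\<close> touches the envelope of the zero set
  of \<open>g\<close> where \<open>y = - dm / dr\<close>. Moving along the envelope within the ellipse is possible only in
  the direction of the line, so \<open>y\<close>, as a function of \<open>r\<close>, has derivative 0 unless the line is
  tangent to the ellipse; by Sard's theorem the latter happens often.\<close>

lemma infinite_tangents:
  fixes a c p :: real
  assumes ac: "a > 0" "c > 0"
    and nz: "\<And>m r. g m r = 0 \<Longrightarrow> gm m r \<noteq> 0"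
    and fin: "\<And>r. finite {m. g m r = 0}"
    and B: "countable B"
    and cov: "\<And>y. y \<in> {-c<..<c} - B \<Longrightarrow> \<exists>x m r. c\<^sup>2 * (x - p)\<^sup>2 + a\<^sup>2 * y\<^sup>2 = a\<^sup>2 * c\<^sup>2 \<and>
      m = x - r * y \<and> g m r = 0 \<and> gr m r = y * gm m r"
  shows "infinite {r. \<exists>m. g m r = 0 \<and> (m - p)\<^sup>2 = a\<^sup>2 + c\<^sup>2 * r\<^sup>2}"
proof
  assume fin_T: "finite {r. \<exists>m. g m r = 0 \<and> (m - p)\<^sup>2 = a\<^sup>2 + c\<^sup>2 * r\<^sup>2}"
  define Y where "Y m r = gr m r / gm m r" for m r
  define K where "K = {(m, r). g m r = 0 \<and> c\<^sup>2 * (m + r * Y m r - p)\<^sup>2 + a\<^sup>2 * (Y m r)\<^sup>2 = a\<^sup>2 * c\<^sup>2}"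
  \<comment> \<open>The line \<open>x - r * y = m\<close> has direction \<open>(r, 1)\<close>; the
    equation says that it is orthogonal to the gradient of the ellipse at the touching
    point.\<close>
  define T where "T = {(m, r) \<in> K. r * (c\<^sup>2 * (m + r * Y m r - p)) + a\<^sup>2 * Y m r = 0}"
  have tangent: "(m - p)\<^sup>2 = a\<^sup>2 + c\<^sup>2 * r\<^sup>2" if "(m, r) \<in> T" for m r
  proof -
    define x y where "x = m + r * Y m r - p" and "y = Y m r"
    have 1: "c\<^sup>2 * x\<^sup>2 + a\<^sup>2 * y\<^sup>2 = a\<^sup>2 * c\<^sup>2" and 2: "r * (c\<^sup>2 * x) + a\<^sup>2 * y = 0"
      using that by (auto simp: T_def K_def x_def y_def)
    have m: "m - p = x - r * y" by (simp add: x_def y_def)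
    have "a\<^sup>2 * c\<^sup>2 * ((m - p)\<^sup>2 - (a\<^sup>2 + c\<^sup>2 * r\<^sup>2)) = 0"
      unfolding m using 1 2 by Groebner_Basis.algebra
    then show ?thesis using ac by simp
  qed
  have "finite T"
  proof (rule finite_subset)
    let ?R = "{r. \<exists>m. g m r = 0 \<and> (m - p)\<^sup>2 = a\<^sup>2 + c\<^sup>2 * r\<^sup>2}"
    show "T \<subseteq> (\<Union>r\<in>?R. (\<lambda>m. (m, r)) ` {m. g m r = 0})"
    proof
      fix q assume q: "q \<in> T"
      obtain m r where mr: "q = (m, r)" by fastforce
      have "g m r = 0" using q by (simp add: T_def K_def mr)
      moreover have "(m - p)\<^sup>2 = a\<^sup>2 + c\<^sup>2 * r\<^sup>2" using tangent q mr by blast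
      ultimately show "q \<in> (\<Union>r\<in>?R. (\<lambda>m. (m, r)) ` {m. g m r = 0})" unfolding mr by blast
    qed
    show "finite (\<Union>r\<in>?R. (\<lambda>m. (m, r)) ` {m. g m r = 0})"
      by (rule finite_UN_I[OF fin_T]) (intro finite_imageI fin)
  qed
  have "\<forall>q\<in>K. \<exists>U L. open U \<and> q \<in> U \<and> (\<forall>m r m' r'. (m, r) \<in> U \<longrightarrow> (m', r') \<in> U \<longrightarrow>
      g m r = 0 \<longrightarrow> g m' r' = 0 \<longrightarrow> \<bar>m' - m\<bar> \<le> L * \<bar>r' - r\<bar>)"
    using zero_set_lipschitz nz by (auto simp: K_def)
  then obtain U L where U: "\<And>q. q \<in> K \<Longrightarrow> open (U q)" "\<And>q. q \<in> K \<Longrightarrow> q \<in> U q"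
    and lip: "\<And>q m r m' r'. q \<in> K \<Longrightarrow> (m, r) \<in> U q \<Longrightarrow> (m', r') \<in> U q \<Longrightarrow>
      g m r = 0 \<Longrightarrow> g m' r' = 0 \<Longrightarrow> \<bar>m' - m\<bar> \<le> L q * \<bar>r' - r\<bar>"
    by metis
  \<comment> \<open>Only countably many null sets may be united, so countably many of the
    neighbourhoods have to suffice.\<close>
  obtain F where F: "F \<subseteq> U ` K" "countable F" "\<Union>F = \<Union>(U ` K)"
  proof (rule Lindelof)
    show "open V" if "V \<in> U ` K" for V using that U(1) by blast
  qed
  define S where "S V = {r. \<exists>m. (m, r) \<in> V \<inter> (K - T)}" for V
  define \<mu> where "\<mu> V r = (SOME m. (m, r) \<in> V \<inter> (K - T))" for V r
  define f where "f V r = Y (\<mu> V r) r" for V r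
  have \<mu>: "(\<mu> V r, r) \<in> V \<inter> (K - T)" if "r \<in> S V" for V r
    using that unfolding S_def \<mu>_def mem_Collect_eq by (rule someI_ex)
  have deriv: "(f V has_real_derivative 0) (at r0 within S V)" if V: "V \<in> F" and r0: "r0 \<in> S V" for V r0
  proof (cases "at r0 within S V = bot")
    \<comment> \<open>At an isolated point of \<open>S V\<close>, every number is a
      derivative.\<close>
    case True
    then show ?thesis by (simp add: has_field_derivative_iff)
  next
    case False
    obtain q where q: "q \<in> K" "V = U q" using V F by blast
    define m0 where "m0 = \<mu> V r0"
    have K0: "(m0, r0) \<in> K" "(m0, r0) \<notin> T" using \<mu>[OF r0] by (auto simp: m0_def)
    have gz: "g (\<mu> V r) r = 0" if "r \<in> S V" for r using \<mu>[OF that] by (auto simp: K_def)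
    have nz0: "gm m0 r0 \<noteq> 0" using gz[OF r0] nz by (simp add: m0_def)
    have dm: "(\<mu> V has_real_derivative - f V r0) (at r0 within S V)"
      unfolding f_def Y_def
    proof (rule zero_set_deriv)
      show "\<bar>\<mu> V r - \<mu> V r0\<bar> \<le> L q * \<bar>r - r0\<bar>" if "r \<in> S V" for r
        using lip[OF q(1), of "\<mu> V r0" r0 "\<mu> V r" r] \<mu>[OF r0] \<mu>[OF that] q(2) gz r0 that by blast
    qed (use gz r0 nz0 m0_def in auto)
    then have \<mu>_diff: "\<mu> V differentiable (at r0 within S V)"
      using real_differentiable_def by blast
    have "(\<lambda>r. gm (\<mu> V r) r) differentiable (at r0 within S V)"
      by (rule differentiable_along_graph[OF diff_gm \<mu>_diff])
    moreover have "(\<lambda>r. gr (\<mu> V r) r) differentiable (at r0 within S V)"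
      by (rule differentiable_along_graph[OF diff_gr \<mu>_diff])
    ultimately have "f V differentiable (at r0 within S V)"
      unfolding f_def Y_def using nz0 by (auto intro!: differentiable_divide simp: m0_def)
    then obtain D where D: "(f V has_real_derivative D) (at r0 within S V)"
      using real_differentiableE by blast
    \<comment> \<open>\<open>\<Phi>\<close> is constant on \<open>S V\<close>. Since
      \<open>\<mu> V\<close> has derivative \<open>- f V\<close>, the abscissa
      \<open>\<mu> V r + r * f V r\<close> has derivative \<open>r0 * D\<close>; differentiating
      \<open>\<Phi>\<close> thus gives \<open>2 * D\<close> times the tangency expression.\<close>
    define \<Phi> where "\<Phi> r = c\<^sup>2 * (\<mu> V r + r * f V r - p)\<^sup>2 + a\<^sup>2 * (f V r)\<^sup>2" for r
    have "(\<Phi> has_real_derivative (c\<^sup>2 * (2 * (\<mu> V r0 + r0 * f V r0 - p) * (r0 * D)) + a\<^sup>2 * (2 * f V r0 * D)))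
        (at r0 within S V)"
      unfolding \<Phi>_def by (auto intro!: derivative_eq_intros dm D)
    then have "((\<lambda>r. (\<Phi> r - \<Phi> r0) / (r - r0)) \<longlongrightarrow>
        c\<^sup>2 * (2 * (\<mu> V r0 + r0 * f V r0 - p) * (r0 * D)) + a\<^sup>2 * (2 * f V r0 * D)) (at r0 within S V)"
      by (simp add: has_field_derivative_iff)
    moreover have "((\<lambda>r. (\<Phi> r - \<Phi> r0) / (r - r0)) \<longlongrightarrow> 0) (at r0 within S V)"
    proof (rule Lim_transform_eventually[OF tendsto_const])
      have \<Phi>: "\<Phi> r = a\<^sup>2 * c\<^sup>2" if "r \<in> S V" for r
        using \<mu>[OF that] by (auto simp: K_def \<Phi>_def f_def)
      have "\<forall>\<^sub>F r in at r0 within S V. r \<in> S V" by (simp add: eventually_at_topological) blast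
      then show "\<forall>\<^sub>F r in at r0 within S V. 0 = (\<Phi> r - \<Phi> r0) / (r - r0)"
        by eventually_elim (simp add: \<Phi> r0)
    qed
    ultimately have "c\<^sup>2 * (2 * (\<mu> V r0 + r0 * f V r0 - p) * (r0 * D)) + a\<^sup>2 * (2 * f V r0 * D) = 0"
      using tendsto_unique[OF False] by blast
    then have "2 * D * (r0 * (c\<^sup>2 * (m0 + r0 * Y m0 r0 - p)) + a\<^sup>2 * Y m0 r0) = 0"
      unfolding m0_def f_def by (simp add: algebra_simps)
    then have "D = 0" using K0 by (auto simp: T_def)
    with D show ?thesis by simp
  qed
  have "{-c<..<c} \<subseteq> (B \<union> (\<lambda>(m, r). Y m r) ` T) \<union> (\<Union>V\<in>F. f V ` S V)"
  proof
    fix y assume y: "y \<in> {-c<..<c}"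
    show "y \<in> (B \<union> (\<lambda>(m, r). Y m r) ` T) \<union> (\<Union>V\<in>F. f V ` S V)"
    proof (cases "y \<in> B")
      case False
      with cov y obtain x m r where x: "c\<^sup>2 * (x - p)\<^sup>2 + a\<^sup>2 * y\<^sup>2 = a\<^sup>2 * c\<^sup>2" "m = x - r * y"
        and g: "g m r = 0" "gr m r = y * gm m r" by blast
      have Y: "Y m r = y" using g nz by (simp add: Y_def)
      have K: "(m, r) \<in> K" using x g Y by (simp add: K_def)
      show ?thesis
      proof (cases "(m, r) \<in> T")
        case True
        then show ?thesis using Y by force
      next
        case False
        obtain V where V: "V \<in> F" "(m, r) \<in> V" using U(2)[OF K] K F(3) by blast
        have r: "r \<in> S V" using V K False by (auto simp: S_def)
        obtain q where q: "q \<in> K" "V = U q" using V F by blast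
        \<comment> \<open>The Lipschitz bound for equal parameters identifies the chosen zero with
          \<open>m\<close>.\<close>
        have "\<bar>\<mu> V r - m\<bar> \<le> L q * \<bar>r - r\<bar>"
          using lip[OF q(1), of m r "\<mu> V r" r] V q \<mu>[OF r] g by (auto simp: K_def)
        then have "f V r = y" using Y by (simp add: f_def)
        then show ?thesis using V r by blast
      qed
    qed simp
  qed
  moreover have "countable (B \<union> (\<lambda>(m, r). Y m r) ` T)"
    by (intro countable_Un B countable_image countable_finite \<open>finite T\<close>)
  then have "\<not> {-c<..<c} \<subseteq> (B \<union> (\<lambda>(m, r). Y m r) ` T) \<union> (\<Union>V\<in>F. f V ` S V)"
    by (rule interval_not_covered[rotated, OF _ F(2) deriv]) (use ac in auto)
  ultimately show False by contradiction
qed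

end

section \<open>Kippenhahn curves with elliptic branches\<close>

text \<open>With major half-axis \<open>a\<close>, both directions rest on the linear formulas
  \<open>a * u = a\<^sup>2 - x * X\<close> and \<open>a * v = a\<^sup>2 + x * X\<close> for the
  focal distances.\<close>

lemma mem_ellipse_iff:
  assumes c: "c > 0" and fg: "g \<le> f"
  shows "z \<in> ellipse f g c \<longleftrightarrow>
    c\<^sup>2 * (Re z - (f + g) / 2)\<^sup>2 + (((f - g) / 2)\<^sup>2 + c\<^sup>2) * (Im z)\<^sup>2 = (((f - g) / 2)\<^sup>2 + c\<^sup>2) * c\<^sup>2"
proof -
  define X x y where "X = (f - g) / 2" and "x = Re z - (f + g) / 2" and "y = Im z"
  define a where "a = sqrt (X\<^sup>2 + c\<^sup>2)"
  define u v where "u = cmod (z - complex_of_real f)" and "v = cmod (z - complex_of_real g)"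
  have X: "X \<ge> 0" using fg by (simp add: X_def)
  have a2: "a\<^sup>2 = X\<^sup>2 + c\<^sup>2" by (simp add: a_def)
  have a0: "a > 0" using c by (simp add: a_def add_nonneg_pos)
  have u2: "u\<^sup>2 = (x - X)\<^sup>2 + y\<^sup>2" and v2: "v\<^sup>2 = (x + X)\<^sup>2 + y\<^sup>2"
  proof -
    have "Re z - f = x - X" "Re z - g = x + X" unfolding x_def X_def by argo+
    then show "u\<^sup>2 = (x - X)\<^sup>2 + y\<^sup>2" "v\<^sup>2 = (x + X)\<^sup>2 + y\<^sup>2"
      by (simp_all add: u_def v_def cmod_power2 y_def)
  qed
  have uv0: "u \<ge> 0" "v \<ge> 0" by (simp_all add: u_def v_def)
  have "z \<in> ellipse f g c \<longleftrightarrow> u + v = 2 * a"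
    using fg by (simp add: ellipse_def u_def v_def a_def X_def)
  also have "\<dots> \<longleftrightarrow> c\<^sup>2 * x\<^sup>2 + a\<^sup>2 * y\<^sup>2 = a\<^sup>2 * c\<^sup>2"
  proof
    assume sum: "u + v = 2 * a"
    have "(v - u) * (u + v) = v\<^sup>2 - u\<^sup>2" by Groebner_Basis.algebra
    also have "\<dots> = 4 * x * X" unfolding u2 v2 by Groebner_Basis.algebra
    finally have "a * (v - u) = 2 * x * X" unfolding sum by (simp add: algebra_simps)
    moreover have "a * (u + v) = 2 * a\<^sup>2" unfolding sum by Groebner_Basis.algebra
    ultimately have "a * u = a\<^sup>2 - x * X" by (simp add: algebra_simps)
    then have "a\<^sup>2 * u\<^sup>2 = (a\<^sup>2 - x * X)\<^sup>2" by (metis power_mult_distrib)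
    then show "c\<^sup>2 * x\<^sup>2 + a\<^sup>2 * y\<^sup>2 = a\<^sup>2 * c\<^sup>2" unfolding u2 a2 by Groebner_Basis.algebra
  next
    assume eq: "c\<^sup>2 * x\<^sup>2 + a\<^sup>2 * y\<^sup>2 = a\<^sup>2 * c\<^sup>2"
    have "c\<^sup>2 * x\<^sup>2 \<le> c\<^sup>2 * a\<^sup>2" using eq by (smt (verit) mult.commute zero_le_mult_iff zero_le_power2)
    then have "x\<^sup>2 \<le> a\<^sup>2" using c by simp
    then have x: "\<bar>x\<bar> \<le> a" using a0 by (simp add: abs_le_square_iff[symmetric])
    have "X\<^sup>2 \<le> a\<^sup>2" using a2 by simp
    then have "X \<le> a" using a0 X by (simp add: power_mono_iff)
    have "\<bar>x * X\<bar> \<le> a * a" unfolding abs_mult using x \<open>X \<le> a\<close> X a0 by (intro mult_mono) auto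
    then have nn: "a\<^sup>2 - x * X \<ge> 0" "a\<^sup>2 + x * X \<ge> 0" by (auto simp: power2_eq_square)
    have "(a * u)\<^sup>2 = (a\<^sup>2 - x * X)\<^sup>2" "(a * v)\<^sup>2 = (a\<^sup>2 + x * X)\<^sup>2"
      using eq unfolding power_mult_distrib u2 v2 a2 by Groebner_Basis.algebra+
    then have "a * u = a\<^sup>2 - x * X" "a * v = a\<^sup>2 + x * X"
      using nn a0 uv0 by (simp_all add: power2_eq_iff_nonneg)
    then have "a * (u + v) = a * (2 * a)" by (simp add: power2_eq_square algebra_simps)
    then show "u + v = 2 * a" using a0 by simp
  qed
  finally show ?thesis unfolding a2 by (simp add: x_def y_def X_def)
qed

lemma uminus_ellipse: "uminus ` ellipse f g c = ellipse (- g) (- f) c"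
proof -
  have *: "- z \<in> ellipse (- g) (- f) c" if "z \<in> ellipse f g c" for z f g
  proof -
    have eqs: "cmod (- z - complex_of_real (- g)) = cmod (z - complex_of_real g)"
      "cmod (- z - complex_of_real (- f)) = cmod (z - complex_of_real f)"
      "\<bar>- g - - f\<bar> = \<bar>f - g\<bar>"
      by (simp_all add: norm_minus_commute)
    show ?thesis
      using that unfolding ellipse_def mem_Collect_eq eqs by (simp only: add.commute)
  qed
  show ?thesis
  proof
    show "ellipse (- g) (- f) c \<subseteq> uminus ` ellipse f g c"
    proof
      fix z assume "z \<in> ellipse (- g) (- f) c"
      from *[OF this] have "- z \<in> ellipse f g c" by simp
      then show "z \<in> uminus ` ellipse f g c" by (intro image_eqI[of _ _ "- z"]) auto
    qed
  qed (use * in auto)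
qed

text \<open>Zeros accumulating at \<open>x\<close> are enough, as limits may be computed along them.
  This is what is available when a function switches between branches.\<close>

lemma frequently_zero_imp_deriv_zero:
  fixes d :: "real \<Rightarrow> real"
  assumes d: "(d has_real_derivative D) (at x)" and zero: "\<exists>\<^sub>F s in at x. d s = 0"
  shows "d x = 0" "D = 0"
proof -
  have lim0: "l = 0" if "(q \<longlongrightarrow> l) (at x)" "\<exists>\<^sub>F s in at x. q s = 0" for q :: "real \<Rightarrow> real" and l
    using tendsto_imp_eventually_ne[OF that(1), of 0] that(2) by (auto simp: frequently_def)
  have "(d \<longlongrightarrow> d x) (at x)" using DERIV_isCont[OF d] by (simp add: isCont_def)
  from lim0[OF this zero] show d0: "d x = 0" .
  have "((\<lambda>s. (d s - d x) / (s - x)) \<longlongrightarrow> D) (at x)" using d by (simp add: has_field_derivative_iff)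
  moreover have "\<exists>\<^sub>F s in at x. (d s - d x) / (s - x) = 0"
    using zero by (rule frequently_elim1) (simp add: d0)
  ultimately show "D = 0" by (rule lim0)
qed

text \<open>A local branch \<open>\<mu>\<close> may switch between the \<open>h i\<close>, but by
  the pigeonhole principle it agrees with one of them at points accumulating at
  \<open>\<theta>\<close>, and then shares its value and derivative at
  \<open>\<theta>\<close>.\<close>

lemma kippenhahn_curve_branches:
  assumes I: "finite I"
    and roots: "\<And>x \<theta>. kippenhahn_poly A (complex_of_real x) \<theta> = 0 \<longleftrightarrow> (\<exists>i\<in>I. x = h i \<theta>)"
    and h: "\<And>i \<theta>. i \<in> I \<Longrightarrow> (h i has_real_derivative h' i \<theta>) (at \<theta>)"
  shows "kippenhahn_curve A =
    {z. \<exists>i\<in>I. \<exists>\<theta>. Re (cis \<theta> * z) = h i \<theta> \<and> Re (\<i> * cis \<theta> * z) = h' i \<theta>}" (is "?C = ?D")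
proof
  show "?D \<subseteq> ?C"
  proof
    fix z assume "z \<in> ?D"
    then obtain i \<theta> where i: "i \<in> I" "Re (cis \<theta> * z) = h i \<theta>" "Re (\<i> * cis \<theta> * z) = h' i \<theta>" by auto
    have "\<forall>\<^sub>F s in nhds \<theta>. kippenhahn_poly A (complex_of_real (h i s)) s = 0"
      using roots i(1) by (intro always_eventually) blast
    then show "z \<in> ?C" unfolding kippenhahn_curve_def mem_Collect_eq
      using i h[OF i(1), of \<theta>] by blast
  qed
  show "?C \<subseteq> ?D"
  proof
    fix z assume "z \<in> ?C"
    then obtain \<theta> \<mu> \<mu>' where ev: "\<forall>\<^sub>F s in nhds \<theta>. kippenhahn_poly A (complex_of_real (\<mu> s)) s = 0"
      and \<mu>: "(\<mu> has_real_derivative \<mu>') (at \<theta>)"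
      and z: "Re (cis \<theta> * z) = \<mu> \<theta>" "Re (\<i> * cis \<theta> * z) = \<mu>'"
      unfolding kippenhahn_curve_def by blast
    from ev have "\<forall>\<^sub>F s in at \<theta>. \<exists>i\<in>I. \<mu> s = h i s"
      unfolding roots eventually_nhds_conv_at by simp
    then have "\<exists>\<^sub>F s in at \<theta>. \<exists>i\<in>I. \<mu> s = h i s"
      by (intro eventually_frequently) auto
    from frequently_bex_finite[OF I this]
    obtain i where i: "i \<in> I" "\<exists>\<^sub>F s in at \<theta>. \<mu> s = h i s" by blast
    have "((\<lambda>s. \<mu> s - h i s) has_real_derivative \<mu>' - h' i \<theta>) (at \<theta>)"
      by (intro DERIV_diff \<mu> h i)
    moreover have "\<exists>\<^sub>F s in at \<theta>. \<mu> s - h i s = 0" using i(2) by simp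
    ultimately have "\<mu> \<theta> - h i \<theta> = 0" "\<mu>' - h' i \<theta> = 0"
      by (rule frequently_zero_imp_deriv_zero)+
    then show "z \<in> ?D" using i(1) z by auto
  qed
qed

text \<open>The parameters are the centre \<open>p\<close>, the squared focal distance \<open>q\<close> and the sign \<open>\<epsilon>\<close>, where
  \<open>\<epsilon> = 0\<close> is used for the point 0.\<close>

definition branch :: "real \<Rightarrow> real \<times> real \<times> real \<Rightarrow> real \<Rightarrow> real" where
  "branch e = (\<lambda>(p, q, \<epsilon>) \<theta>. p * cos \<theta> + \<epsilon> * sqrt (q * (cos \<theta>)\<^sup>2 + e))"

definition branch' :: "real \<Rightarrow> real \<times> real \<times> real \<Rightarrow> real \<Rightarrow> real" where
  "branch' e = (\<lambda>(p, q, \<epsilon>) \<theta>. - p * sin \<theta> - \<epsilon> * (q * cos \<theta> * sin \<theta> / sqrt (q * (cos \<theta>)\<^sup>2 + e)))"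

lemma branch_deriv:
  assumes "e > 0" "q \<ge> 0"
  shows "(branch e (p, q, \<epsilon>) has_real_derivative branch' e (p, q, \<epsilon>) \<theta>) (at \<theta>)"
proof -
  have "q * (cos \<theta>)\<^sup>2 + e > 0" using assms by (simp add: add_nonneg_pos)
  then show ?thesis
    unfolding branch_def branch'_def prod.case
    by (auto intro!: derivative_eq_intros simp: field_simps)
qed

text \<open>The touching point has \<open>x = \<epsilon> * (q + e) * cos \<theta> / D\<close>
  relative to the centre and \<open>y = - \<epsilon> * e * sin \<theta> / D\<close>, where
  \<open>D = sqrt (q * (cos \<theta>)\<^sup>2 + e)\<close>. Either sign traces the whole ellipse,
  because a change of sign amounts to adding \<open>pi\<close> to the angle.\<close>

lemma branch_envelope:
  assumes e: "e > 0" and q: "q \<ge> 0" and \<epsilon>: "\<epsilon> = 1 \<or> \<epsilon> = -1"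
  shows "(\<exists>\<theta>. Re (cis \<theta> * z) = branch e (p, q, \<epsilon>) \<theta> \<and> Re (\<i> * cis \<theta> * z) = branch' e (p, q, \<epsilon>) \<theta>) \<longleftrightarrow>
    e * (Re z - p)\<^sup>2 + (q + e) * (Im z)\<^sup>2 = (q + e) * e"
proof -
  define x y where "x = Re z - p" and "y = Im z"
  have \<epsilon>2: "\<epsilon>\<^sup>2 = 1" using \<epsilon> by auto
  have param: "(Re (cis \<theta> * z) = branch e (p, q, \<epsilon>) \<theta> \<and> Re (\<i> * cis \<theta> * z) = branch' e (p, q, \<epsilon>) \<theta>) \<longleftrightarrow>
      x * D = \<epsilon> * (q + e) * C \<and> y * D = - \<epsilon> * e * S"
    if D: "D = sqrt (q * (cos \<theta>)\<^sup>2 + e)" and C: "C = cos \<theta>" and S: "S = sin \<theta>" for \<theta> C S D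
  proof -
    have CS: "C\<^sup>2 + S\<^sup>2 = 1" by (simp add: C S)
    have D0: "D > 0" unfolding D using e q by (simp add: add_nonneg_pos)
    have D2: "D\<^sup>2 = q * C\<^sup>2 + e" unfolding D C using e q by simp
    have "(Re (cis \<theta> * z) = branch e (p, q, \<epsilon>) \<theta> \<and> Re (\<i> * cis \<theta> * z) = branch' e (p, q, \<epsilon>) \<theta>) \<longleftrightarrow>
       C * x - S * y = \<epsilon> * D \<and> - (S * x) - C * y = - (\<epsilon> * (q * C * S / D))"
      unfolding branch_def branch'_def prod.case D[symmetric]
      by (simp add: x_def y_def C S algebra_simps)
    also have "\<dots> \<longleftrightarrow> D * (C * x - S * y) = \<epsilon> * D\<^sup>2 \<and> D * (S * x + C * y) = \<epsilon> * (q * C * S)"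
    proof -
      have "t = \<epsilon> * D \<longleftrightarrow> D * t = \<epsilon> * D\<^sup>2" for t
        using D0 by (metis less_irrefl mult.left_commute mult_cancel_left power2_eq_square)
      moreover have "- (S * x) - C * y = - (\<epsilon> * (q * C * S / D)) \<longleftrightarrow> D * (S * x + C * y) = \<epsilon> * (q * C * S)"
        using D0 by (auto simp: field_simps)
      ultimately show ?thesis by blast
    qed
    also have "\<dots> \<longleftrightarrow> x * D = \<epsilon> * (q + e) * C \<and> y * D = - \<epsilon> * e * S"
    proof (intro iffI conjI; elim conjE)
      assume 1: "D * (C * x - S * y) = \<epsilon> * D\<^sup>2" and 2: "D * (S * x + C * y) = \<epsilon> * (q * C * S)"
      have "x * D = x * D * (C\<^sup>2 + S\<^sup>2)" by (simp add: CS)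
      also have "\<dots> = C * (D * (C * x - S * y)) + S * (D * (S * x + C * y))" by Groebner_Basis.algebra
      also have "\<dots> = \<epsilon> * C * (q * (C\<^sup>2 + S\<^sup>2) + e)" unfolding 1 2 D2 by Groebner_Basis.algebra
      finally show "x * D = \<epsilon> * (q + e) * C" by (simp add: CS)
      have "y * D = y * D * (C\<^sup>2 + S\<^sup>2)" by (simp add: CS)
      also have "\<dots> = C * (D * (S * x + C * y)) - S * (D * (C * x - S * y))" by Groebner_Basis.algebra
      also have "\<dots> = - \<epsilon> * e * S" unfolding 1 2 D2 by Groebner_Basis.algebra
      finally show "y * D = - \<epsilon> * e * S" .
    next
      assume 1: "x * D = \<epsilon> * (q + e) * C" and 2: "y * D = - \<epsilon> * e * S"
      have "D * (C * x - S * y) = C * (x * D) - S * (y * D)" by Groebner_Basis.algebra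
      also have "\<dots> = \<epsilon> * (q * C\<^sup>2 + e * (C\<^sup>2 + S\<^sup>2))" unfolding 1 2 by Groebner_Basis.algebra
      finally show "D * (C * x - S * y) = \<epsilon> * D\<^sup>2" by (simp add: CS D2)
      have "D * (S * x + C * y) = S * (x * D) + C * (y * D)" by Groebner_Basis.algebra
      also have "\<dots> = \<epsilon> * (q * C * S)" unfolding 1 2 by Groebner_Basis.algebra
      finally show "D * (S * x + C * y) = \<epsilon> * (q * C * S)" .
    qed
    finally show ?thesis .
  qed
  have "(\<exists>\<theta>. Re (cis \<theta> * z) = branch e (p, q, \<epsilon>) \<theta> \<and> Re (\<i> * cis \<theta> * z) = branch' e (p, q, \<epsilon>) \<theta>) \<longleftrightarrow>
    e * x\<^sup>2 + (q + e) * y\<^sup>2 = (q + e) * e" (is "?L \<longleftrightarrow> ?R")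
  proof
    assume ?L
    then obtain \<theta> where \<theta>: "Re (cis \<theta> * z) = branch e (p, q, \<epsilon>) \<theta> \<and> Re (\<i> * cis \<theta> * z) = branch' e (p, q, \<epsilon>) \<theta>"
      by blast
    define C S D where "C = cos \<theta>" and "S = sin \<theta>" and "D = sqrt (q * (cos \<theta>)\<^sup>2 + e)"
    have CS: "C\<^sup>2 + S\<^sup>2 = 1" by (simp add: C_def S_def)
    have D0: "D > 0" unfolding D_def using e q by (simp add: add_nonneg_pos)
    have D2: "D\<^sup>2 = q * C\<^sup>2 + e" unfolding D_def C_def using e q by simp
    have eqs: "x * D = \<epsilon> * (q + e) * C" "y * D = - \<epsilon> * e * S"
      using \<theta> param[OF D_def C_def S_def] by auto
    have "D\<^sup>2 * (e * x\<^sup>2 + (q + e) * y\<^sup>2) = e * (x * D)\<^sup>2 + (q + e) * (y * D)\<^sup>2" by Groebner_Basis.algebra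
    also have "\<dots> = \<epsilon>\<^sup>2 * ((q + e) * e * (q * C\<^sup>2 + e * (C\<^sup>2 + S\<^sup>2)))" unfolding eqs by Groebner_Basis.algebra
    also have "\<dots> = D\<^sup>2 * ((q + e) * e)" by (simp add: \<epsilon>2 CS D2)
    finally show ?R using D0 by simp
  next
    assume eq: ?R
    \<comment> \<open>These are to be \<open>cos \<theta> / D\<close> and
      \<open>sin \<theta> / D\<close>, so their norm \<open>n\<close> has to be
      \<open>1 / D\<close>.\<close>
    define v1 v2 where "v1 = \<epsilon> * x / (q + e)" and "v2 = - \<epsilon> * y / e"
    have qe: "q + e > 0" using q e by simp
    define n where "n = sqrt (v1\<^sup>2 + v2\<^sup>2)"
    have x: "x = \<epsilon> * (q + e) * v1" and y: "y = - \<epsilon> * e * v2"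
      using \<epsilon> qe e by (auto simp: v1_def v2_def)
    have "e * x\<^sup>2 + (q + e) * y\<^sup>2 = \<epsilon>\<^sup>2 * ((q + e) * e * ((q + e) * v1\<^sup>2 + e * v2\<^sup>2))"
      unfolding x y by Groebner_Basis.algebra
    then have "(q + e) * e * ((q + e) * v1\<^sup>2 + e * v2\<^sup>2) = (q + e) * e * 1"
      using eq \<epsilon>2 by simp
    then have eq': "(q + e) * v1\<^sup>2 + e * v2\<^sup>2 = 1" using qe e by simp
    then have "v1\<^sup>2 + v2\<^sup>2 \<noteq> 0" by (auto simp: sum_power2_eq_zero_iff)
    then have "v1\<^sup>2 + v2\<^sup>2 > 0" by (smt (verit) zero_le_power2)
    then have n: "n > 0" "n\<^sup>2 = v1\<^sup>2 + v2\<^sup>2" by (simp_all add: n_def)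
    have "(v1 / n)\<^sup>2 + (v2 / n)\<^sup>2 = 1"
      unfolding power_divide add_divide_distrib[symmetric] n(2)[symmetric] using n(1) by simp
    then obtain \<theta> where \<theta>: "v1 / n = cos \<theta>" "v2 / n = sin \<theta>" using sincos_total_2pi by metis
    have "q * (v1 / n)\<^sup>2 + e = (1 / n)\<^sup>2"
    proof -
      have "q * v1\<^sup>2 + e * n\<^sup>2 = 1" using eq' unfolding n(2) by (simp add: algebra_simps)
      then show ?thesis using n(1) by (simp add: power_divide field_simps)
    qed
    then have D: "1 / n = sqrt (q * (cos \<theta>)\<^sup>2 + e)" using n by (simp add: \<theta>[symmetric] real_sqrt_unique)
    show ?L
      using param[OF D \<theta>] x y by auto
  qed
  then show ?thesis by (simp add: x_def y_def)
qed

section \<open>Affine coordinates on the dual curve\<close>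

lemma path_poly_scale:
  fixes w :: "nat \<Rightarrow> real"
  shows "path_poly (\<lambda>j. u\<^sup>2 * w j) (u * m) = u ^ 7 * path_poly w m"
  unfolding path_poly_def match_defs by Groebner_Basis.algebra

lemma path_poly_minus:
  fixes w :: "nat \<Rightarrow> 'a::comm_ring_1"
  shows "path_poly w (- x) = - path_poly w x"
  unfolding path_poly_def by (simp add: algebra_simps)

lemma path_poly_deriv:
  fixes w :: "nat \<Rightarrow> real"
  shows "(path_poly w has_real_derivative path_poly' w x) (at x)"
  unfolding path_poly_def path_poly'_def by (auto intro!: derivative_eq_intros)

lemma finite_path_poly_roots:
  fixes w :: "nat \<Rightarrow> real"
  shows "finite {x. path_poly w x = 0}"
proof -
  have "path_poly w x = poly [:0, - match3 w, 0, match2 w, 0, - match1 w, 0, 1:] x" for x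
    unfolding path_poly_def by (simp add: algebra_simps eval_nat_numeral)
  then show ?thesis by (simp only:) (rule poly_roots_finite, simp)
qed

text \<open>In terms of \<open>r = tan \<theta>\<close> and \<open>m = \<lambda> / cos \<theta>\<close>, the line belonging to \<open>\<lambda>\<close> and \<open>\<theta>\<close> is
  \<open>x - r * y = m\<close>, and the Kippenhahn polynomial becomes a polynomial in \<open>m\<close> and \<open>r\<close>.\<close>

definition aff :: "(nat \<Rightarrow> real) \<Rightarrow> real \<Rightarrow> real \<Rightarrow> real" where
  "aff \<xi> m r = path_poly (\<lambda>j. 1 + \<xi> j * (1 + r\<^sup>2)) m"

definition aff_m :: "(nat \<Rightarrow> real) \<Rightarrow> real \<Rightarrow> real \<Rightarrow> real" where
  "aff_m \<xi> m r = path_poly' (\<lambda>j. 1 + \<xi> j * (1 + r\<^sup>2)) m"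

definition aff_r :: "(nat \<Rightarrow> real) \<Rightarrow> real \<Rightarrow> real \<Rightarrow> real" where
  "aff_r \<xi> m r = 2 * r * ((lin2 \<xi> + 2 * match2 \<xi> * (1 + r\<^sup>2)) * m ^ 3 - match1 \<xi> * m ^ 5
     - (lin3 \<xi> + 2 * quad3 \<xi> * (1 + r\<^sup>2) + 3 * match3 \<xi> * (1 + r\<^sup>2)\<^sup>2) * m)"

lemma aff_expand:
  "aff \<xi> m r = m ^ 7 - (6 + match1 \<xi> * (1 + r\<^sup>2)) * m ^ 5
    + (10 + lin2 \<xi> * (1 + r\<^sup>2) + match2 \<xi> * (1 + r\<^sup>2)\<^sup>2) * m ^ 3
    - (4 + lin3 \<xi> * (1 + r\<^sup>2) + quad3 \<xi> * (1 + r\<^sup>2)\<^sup>2 + match3 \<xi> * (1 + r\<^sup>2) ^ 3) * m"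
  unfolding aff_def path_poly_def match_affine by simp

lemma aff_m_expand:
  "aff_m \<xi> m r = 7 * m ^ 6 - 5 * (6 + match1 \<xi> * (1 + r\<^sup>2)) * m ^ 4
    + 3 * (10 + lin2 \<xi> * (1 + r\<^sup>2) + match2 \<xi> * (1 + r\<^sup>2)\<^sup>2) * m\<^sup>2
    - (4 + lin3 \<xi> * (1 + r\<^sup>2) + quad3 \<xi> * (1 + r\<^sup>2)\<^sup>2 + match3 \<xi> * (1 + r\<^sup>2) ^ 3)"
  unfolding aff_m_def path_poly'_def match_affine by simp

lemma aff_chain:
  assumes M: "(M has_real_derivative M') (at x)" and T: "(T has_real_derivative T') (at x)"
  shows "((\<lambda>s. aff \<xi> (M s) (T s)) has_real_derivative
    aff_m \<xi> (M x) (T x) * M' + aff_r \<xi> (M x) (T x) * T') (at x)"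
  unfolding aff_expand
  by (rule derivative_eq_intros M T refl)+
    (unfold aff_m_expand aff_r_def, simp add: algebra_simps eval_nat_numeral)

lemma implicit_curve_aff: "implicit_curve (aff \<xi>) (aff_m \<xi>) (aff_r \<xi>)"
proof
  fix m r :: real and p :: "real \<times> real"
  show "((\<lambda>m. aff \<xi> m r) has_real_derivative aff_m \<xi> m r) (at m)"
    unfolding aff_def aff_m_def by (rule path_poly_deriv)
  show "(aff \<xi> m has_real_derivative aff_r \<xi> m r) (at r)"
    using aff_chain[of "\<lambda>_. m" 0 r "\<lambda>s. s" 1 \<xi>] by simp
  have [derivative_intros]: "fst differentiable (at p)" "snd differentiable (at p)"
    by (auto intro: bounded_linear_imp_differentiable bounded_linear_fst bounded_linear_snd)
  show "(\<lambda>p. aff_m \<xi> (fst p) (snd p)) differentiable (at p)"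
    unfolding aff_m_expand by (intro derivative_intros)
  show "(\<lambda>p. aff_r \<xi> (fst p) (snd p)) differentiable (at p)"
    unfolding aff_r_def by (intro derivative_intros)
qed

section \<open>From the curve to common roots\<close>

lemma kippenhahn_poly_of_real:
  assumes "A \<in> reciprocal_mats 7"
  shows "kippenhahn_poly A (complex_of_real x) \<theta> = 0 \<longleftrightarrow> path_poly (\<lambda>j. (cos \<theta>)\<^sup>2 + xi A j) x = 0"
  unfolding kippenhahn_poly_reciprocal[OF assms] path_poly_of_real by simp

text \<open>The second equation is the derivative of \<open>aff (xi A) (M s) (tan s) = 0\<close>, as
  \<open>M\<close> and \<open>tan\<close> have the derivatives
  \<open>- Im z / (cos \<theta>)\<^sup>2\<close> and \<open>1 / (cos \<theta>)\<^sup>2\<close>. For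
  \<open>cos \<theta> = 0\<close> the chart breaks down, but then \<open>Im z\<close> is a root of a
  fixed polynomial.\<close>

lemma kippenhahn_curve_affine:
  assumes A: "A \<in> reciprocal_mats 7" and z: "z \<in> kippenhahn_curve A"
  shows "path_poly (xi A) (Im z) = 0 \<or> (\<exists>r. aff (xi A) (Re z - r * Im z) r = 0 \<and>
    aff_r (xi A) (Re z - r * Im z) r = Im z * aff_m (xi A) (Re z - r * Im z) r)"
proof -
  obtain \<theta> \<mu> \<mu>' where ev: "\<forall>\<^sub>F s in nhds \<theta>. path_poly (\<lambda>j. (cos s)\<^sup>2 + xi A j) (\<mu> s) = 0"
    and \<mu>: "(\<mu> has_real_derivative \<mu>') (at \<theta>)"
    and z1: "cos \<theta> * Re z - sin \<theta> * Im z = \<mu> \<theta>" and z2: "- sin \<theta> * Re z - cos \<theta> * Im z = \<mu>'"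
    using z unfolding kippenhahn_curve_def kippenhahn_poly_of_real[OF A] by auto
  show ?thesis
  proof (cases "cos \<theta> = 0")
    case True
    then have "(sin \<theta>)\<^sup>2 = 1" by (simp add: sin_squared_eq)
    then have "sin \<theta> = 1 \<or> sin \<theta> = -1" by (simp add: power2_eq_1_iff)
    moreover have "path_poly (xi A) (\<mu> \<theta>) = 0"
      using eventually_nhds_x_imp_x[OF ev] True by simp
    moreover have "\<mu> \<theta> = - (sin \<theta> * Im z)" using z1 True by simp
    ultimately have "path_poly (xi A) (Im z) = 0"
      by (elim disjE) (simp_all add: path_poly_minus)
    then show ?thesis ..
  next
    case False
    define M where "M s = \<mu> s / cos s" for s
    have M: "M \<theta> = Re z - tan \<theta> * Im z"
      using z1 False by (simp add: M_def tan_def field_simps)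
    have "\<forall>\<^sub>F s in nhds \<theta>. cos s \<noteq> 0"
    proof -
      have "isCont cos \<theta>" by simp
      then have "(cos \<longlongrightarrow> cos \<theta>) (nhds \<theta>)"
        using False by (simp add: isCont_def tendsto_at_iff_tendsto_nhds)
      from tendsto_imp_eventually_ne[OF this False] show ?thesis .
    qed
    with ev have zero: "\<forall>\<^sub>F s in nhds \<theta>. aff (xi A) (M s) (tan s) = 0"
    proof eventually_elim
      case (elim s)
      have "(cos s)\<^sup>2 * (1 + xi A j * (1 + (tan s)\<^sup>2)) = (cos s)\<^sup>2 + xi A j" for j
      proof -
        have "(cos s)\<^sup>2 * (1 + (tan s)\<^sup>2) = (cos s)\<^sup>2 + (sin s)\<^sup>2"
          using elim(2) by (simp add: tan_def power_divide field_simps)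
        also have "\<dots> = 1" by simp
        finally have *: "(cos s)\<^sup>2 * (1 + (tan s)\<^sup>2) = 1" .
        have "(cos s)\<^sup>2 * (1 + xi A j * (1 + (tan s)\<^sup>2)) =
            (cos s)\<^sup>2 + xi A j * ((cos s)\<^sup>2 * (1 + (tan s)\<^sup>2))"
          by (simp add: algebra_simps)
        then show ?thesis unfolding * by simp
      qed
      moreover have "cos s * M s = \<mu> s" using elim(2) by (simp add: M_def)
      ultimately have "(cos s) ^ 7 * aff (xi A) (M s) (tan s) = 0"
        unfolding aff_def path_poly_scale[symmetric] using elim(1) by simp
      then show ?case using elim(2) by simp
    qed
    have dM: "(M has_real_derivative (\<mu>' * cos \<theta> + \<mu> \<theta> * sin \<theta>) / (cos \<theta>)\<^sup>2) (at \<theta>)"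
      unfolding M_def using \<mu> False
      by (auto intro!: derivative_eq_intros simp: power2_eq_square)
    have "\<mu>' * cos \<theta> + \<mu> \<theta> * sin \<theta> = - (((cos \<theta>)\<^sup>2 + (sin \<theta>)\<^sup>2) * Im z)"
      unfolding z1[symmetric] z2[symmetric] by Groebner_Basis.algebra
    then have dM: "(M has_real_derivative - Im z / (cos \<theta>)\<^sup>2) (at \<theta>)" using dM by simp
    have dT: "(tan has_real_derivative 1 / (cos \<theta>)\<^sup>2) (at \<theta>)"
      using DERIV_tan[OF False] by (simp add: inverse_eq_divide)
    have "((\<lambda>s. aff (xi A) (M s) (tan s)) has_real_derivative 0) (at \<theta>)"
      using DERIV_cong_ev[OF refl zero refl, of 0] by simp
    from DERIV_unique[OF aff_chain[OF dM dT] this]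
    have "(aff_r (xi A) (M \<theta>) (tan \<theta>) - Im z * aff_m (xi A) (M \<theta>) (tan \<theta>)) / (cos \<theta>)\<^sup>2 = 0"
      by (simp add: diff_divide_distrib algebra_simps)
    then have "aff_r (xi A) (M \<theta>) (tan \<theta>) = Im z * aff_m (xi A) (M \<theta>) (tan \<theta>)"
      using False by simp
    moreover have "aff (xi A) (M \<theta>) (tan \<theta>) = 0" using eventually_nhds_x_imp_x[OF zero] .
    ultimately show ?thesis unfolding M by blast
  qed
qed

lemma xi_nonneg: "xi A j \<ge> 0"
  by (simp add: xi_def)

lemma ellipse_subset_curve_imp_common_roots:
  assumes A: "A \<in> reciprocal_mats 7" and c: "c > 0" and fg: "g \<le> f"
    and sub: "ellipse f g c \<subseteq> kippenhahn_curve A"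
  shows "infinite {R. R > 0 \<and> (\<exists>m. path_poly (\<lambda>j. 1 + xi A j * R) m = 0 \<and>
    (m - (f + g) / 2)\<^sup>2 = ((f - g) / 2)\<^sup>2 + c\<^sup>2 * R)}"
proof -
  interpret implicit_curve "aff (xi A)" "aff_m (xi A)" "aff_r (xi A)" by (rule implicit_curve_aff)
  define p X a where "p = (f + g) / 2" and "X = (f - g) / 2" and "a = sqrt (X\<^sup>2 + c\<^sup>2)"
  have a0: "a > 0" using c by (simp add: a_def add_nonneg_pos)
  have a2: "a\<^sup>2 = X\<^sup>2 + c\<^sup>2" by (simp add: a_def)
  have "infinite {r. \<exists>m. aff (xi A) m r = 0 \<and> (m - p)\<^sup>2 = a\<^sup>2 + c\<^sup>2 * r\<^sup>2}" (is "infinite ?S")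
  proof (rule infinite_tangents[where B = "{y. path_poly (xi A) y = 0}"])
    fix m r assume "aff (xi A) m r = 0"
    moreover have "0 < 1 + xi A j * (1 + r\<^sup>2)" for j
      using xi_nonneg[of A j] by (intro add_pos_nonneg mult_nonneg_nonneg) auto
    ultimately show "aff_m (xi A) m r \<noteq> 0"
      unfolding aff_def aff_m_def by (intro path_poly_roots_simple) (auto intro: less_imp_le)
  next
    show "finite {m. aff (xi A) m r = 0}" for r
      unfolding aff_def by (rule finite_path_poly_roots)
  next
    show "countable {y. path_poly (xi A) y = 0}"
      by (intro countable_finite finite_path_poly_roots)
  next
    fix y assume y: "y \<in> {-c<..<c} - {y. path_poly (xi A) y = 0}"
    define x where "x = p + a * sqrt (c\<^sup>2 - y\<^sup>2) / c"
    have "\<bar>y\<bar> \<le> \<bar>c\<bar>" using y c by auto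
    then have "y\<^sup>2 \<le> c\<^sup>2" by (simp only: abs_le_square_iff)
    then have "c\<^sup>2 * (x - p)\<^sup>2 = a\<^sup>2 * (c\<^sup>2 - y\<^sup>2)"
      using c by (simp add: x_def power_mult_distrib power_divide)
    then have eq: "c\<^sup>2 * (x - p)\<^sup>2 + a\<^sup>2 * y\<^sup>2 = a\<^sup>2 * c\<^sup>2" by (simp add: algebra_simps)
    then have "Complex x y \<in> ellipse f g c"
      unfolding mem_ellipse_iff[OF c fg] a2 p_def X_def by simp
    then have "Complex x y \<in> kippenhahn_curve A" using sub by blast
    from kippenhahn_curve_affine[OF A this] y eq
    show "\<exists>x m r. c\<^sup>2 * (x - p)\<^sup>2 + a\<^sup>2 * y\<^sup>2 = a\<^sup>2 * c\<^sup>2 \<and> m = x - r * y \<and>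
        aff (xi A) m r = 0 \<and> aff_r (xi A) m r = y * aff_m (xi A) m r"
      by auto
  qed (use a0 c in auto)
  \<comment> \<open>\<open>r \<mapsto> 1 + r\<^sup>2\<close> is at most two-to-one, so infinitely
    many \<open>r\<close> give infinitely many \<open>R\<close>.\<close>
  have "finite ?S" if fin: "finite {R. R > 0 \<and> (\<exists>m. path_poly (\<lambda>j. 1 + xi A j * R) m = 0 \<and>
    (m - p)\<^sup>2 = X\<^sup>2 + c\<^sup>2 * R)}" (is "finite ?T")
  proof (rule finite_subset)
    show "?S \<subseteq> (\<Union>R\<in>?T. {sqrt (R - 1), - sqrt (R - 1)})"
    proof
      fix r assume "r \<in> ?S"
      then have "1 + r\<^sup>2 \<in> ?T" by (auto simp: aff_def a2 algebra_simps add_pos_nonneg)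
      moreover have "r \<in> {sqrt ((1 + r\<^sup>2) - 1), - sqrt ((1 + r\<^sup>2) - 1)}" by auto
      ultimately show "r \<in> (\<Union>R\<in>?T. {sqrt (R - 1), - sqrt (R - 1)})" by blast
    qed
    show "finite (\<Union>R\<in>?T. {sqrt (R - 1), - sqrt (R - 1)})" using fin by blast
  qed
  with \<open>infinite ?S\<close> show ?thesis unfolding p_def X_def by blast
qed

section \<open>The main result\<close>

lemma foci_squares:
  defines "f \<equiv> sqrt (2 + sqrt 2)" and "g \<equiv> - sqrt (2 - sqrt 2)"
  shows "((f + g) / 2)\<^sup>2 = (2 - sqrt 2) / 2" and "((f - g) / 2)\<^sup>2 = (2 + sqrt 2) / 2" and "g \<le> f"
proof -
  have "sqrt 2 \<le> 2" by (rule real_le_lsqrt) auto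
  then have f2: "f\<^sup>2 = 2 + sqrt 2" and g2: "g\<^sup>2 = 2 - sqrt 2" unfolding f_def g_def by auto
  have "f * g = - sqrt ((2 + sqrt 2) * (2 - sqrt 2))" unfolding f_def g_def by (simp add: real_sqrt_mult)
  also have "(2 + sqrt 2) * (2 - sqrt 2) = (2 :: real)" by (simp add: algebra_simps)
  finally have fg: "f * g = - sqrt 2" .
  show "((f + g) / 2)\<^sup>2 = (2 - sqrt 2) / 2" "((f - g) / 2)\<^sup>2 = (2 + sqrt 2) / 2"
    using f2 g2 fg by (simp_all add: power_divide power2_sum power2_diff)
  have "g \<le> 0" "0 \<le> f" unfolding f_def g_def using \<open>sqrt 2 \<le> 2\<close> by auto
  then show "g \<le> f" by simp
qed

lemma ellipse_subset_curve_imp_xi: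
  assumes A: "A \<in> reciprocal_mats 7" and c: "c > 0"
    and sub: "ellipse (sqrt (2 + sqrt 2)) (- sqrt (2 - sqrt 2)) c \<subseteq> kippenhahn_curve A"
  shows "map (xi A) [1..<7] = map ((*) (c\<^sup>2)) [2 * sqrt 2 - 2, 3 - 2 * sqrt 2, 0, 1, 0, 1] \<or>
    map (xi A) [1..<7] = map ((*) (c\<^sup>2)) [1, 0, 1, 0, 3 - 2 * sqrt 2, 2 * sqrt 2 - 2]"
proof -
  have c2: "c\<^sup>2 > 0" using c by simp
  note coeffs = common_roots_imp_coeffs[OF c2 foci_squares(1,2)
    ellipse_subset_curve_imp_common_roots[OF A c foci_squares(3) sub]]
  have "match1 (xi A) = 2 * c\<^sup>2 + (match1 (xi A) - 2 * c\<^sup>2)" by simp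
  from coeffs_imp_xi[OF c2 xi_nonneg this coeffs] show ?thesis .
qed

text \<open>\<open>xi_vec2\<close> is \<open>sqrt 2 + 1\<close> times the reversal of
  \<open>xi_vec1\<close>; normalized in this way, the factor becomes the square of the minor
  half-axis in both cases.\<close>

lemma xi_multiple_iff:
  "(\<exists>t>0. map h [1..<7] = map (\<lambda>y. t * y) xi_vec1 \<or> map h [1..<7] = map (\<lambda>y. t * y) xi_vec2) \<longleftrightarrow>
   (\<exists>c>0. map h [1..<7] = map ((*) (c\<^sup>2)) [2 * sqrt 2 - 2, 3 - 2 * sqrt 2, 0, 1, 0, 1] \<or>
      map h [1..<7] = map ((*) (c\<^sup>2)) [1, 0, 1, 0, 3 - 2 * sqrt 2, 2 * sqrt 2 - 2])"
    (is "?L \<longleftrightarrow> ?R")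
proof -
  define l1 l2 where "l1 = [2 * sqrt 2 - 2, 3 - 2 * sqrt 2, 0, 1, 0, 1::real]"
    and "l2 = [1, 0, 1, 0, 3 - 2 * sqrt 2, 2 * sqrt 2 - 2::real]"
  have 1: "map ((*) t) xi_vec1 = map ((*) t) l1" for t
    by (simp add: xi_vec1_def l1_def algebra_simps)
  have 2: "map ((*) t) xi_vec2 = map ((*) (t * (sqrt 2 + 1))) l2" for t
    by (simp add: xi_vec2_def l2_def algebra_simps)
  have s: "sqrt 2 + 1 > (0::real)" "sqrt 2 - 1 > (0::real)" "(sqrt 2 - 1) * (sqrt 2 + 1) = (1::real)"
    by (auto simp: add_pos_pos algebra_simps)
  have sq: "\<exists>c>0. c\<^sup>2 = t" if "t > 0" for t :: real
    using that by (intro exI[of _ "sqrt t"]) simp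
  show ?thesis
    unfolding 1 2 l1_def[symmetric] l2_def[symmetric]
  proof
    assume "\<exists>t>0. map h [1..<7] = map ((*) t) l1 \<or> map h [1..<7] = map ((*) (t * (sqrt 2 + 1))) l2"
    then obtain t where "t > 0" "map h [1..<7] = map ((*) t) l1 \<or> map h [1..<7] = map ((*) (t * (sqrt 2 + 1))) l2"
      by blast
    then show "\<exists>c>0. map h [1..<7] = map ((*) (c\<^sup>2)) l1 \<or> map h [1..<7] = map ((*) (c\<^sup>2)) l2"
      using sq[of t] sq[of "t * (sqrt 2 + 1)"] s by (metis mult_pos_pos)
  next
    assume "\<exists>c>0. map h [1..<7] = map ((*) (c\<^sup>2)) l1 \<or> map h [1..<7] = map ((*) (c\<^sup>2)) l2"
    then obtain c where c: "c > 0" "map h [1..<7] = map ((*) (c\<^sup>2)) l1 \<or> map h [1..<7] = map ((*) (c\<^sup>2)) l2"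
      by blast
    have "c\<^sup>2 > 0" "c\<^sup>2 * (sqrt 2 - 1) > 0" "c\<^sup>2 * (sqrt 2 - 1) * (sqrt 2 + 1) = c\<^sup>2"
      using c(1) s by (auto simp: mult.assoc)
    then show "\<exists>t>0. map h [1..<7] = map ((*) t) l1 \<or> map h [1..<7] = map ((*) (t * (sqrt 2 + 1))) l2"
      using c(2) by metis
  qed
qed

section \<open>From the weights to the ellipses\<close>

lemma ellipse_factor_alt:
  "ellipse_factor f g c x \<theta> = (x - complex_of_real ((f + g) / 2) * complex_of_real (cos \<theta>))\<^sup>2
     - (complex_of_real (((f - g) / 2)\<^sup>2) * (complex_of_real (cos \<theta>))\<^sup>2 + complex_of_real (c\<^sup>2))"
proof -
  have "(\<bar>f - g\<bar> / 2)\<^sup>2 = ((f - g) / 2)\<^sup>2" by (simp add: power_divide)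
  then show ?thesis unfolding ellipse_factor_def by (simp only: of_real_add of_real_mult of_real_power)
qed

lemma ellipse_factor_of_real:
  "ellipse_factor f g c (complex_of_real x) \<theta> =
    complex_of_real ((x - (f + g) / 2 * cos \<theta>)\<^sup>2 - (((f - g) / 2)\<^sup>2 * (cos \<theta>)\<^sup>2 + c\<^sup>2))"
  unfolding ellipse_factor_alt by (simp only: of_real_diff of_real_add of_real_mult of_real_power)

context
  fixes A :: "complex mat" and c :: real
  assumes A: "A \<in> reciprocal_mats 7" and c: "c > 0"
    and xi: "map (xi A) [1..<7] = map ((*) (c\<^sup>2)) [2 * sqrt 2 - 2, 3 - 2 * sqrt 2, 0, 1, 0, 1] \<or>
      map (xi A) [1..<7] = map ((*) (c\<^sup>2)) [1, 0, 1, 0, 3 - 2 * sqrt 2, 2 * sqrt 2 - 2]"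
begin

lemma xi_coeffs:
  "match1 (xi A) = 3 * c\<^sup>2" "lin2 (xi A) = (8 + 2 * sqrt 2) * c\<^sup>2" "match2 (xi A) = 3 * (c\<^sup>2)\<^sup>2"
  "lin3 (xi A) = (2 + 4 * sqrt 2) * c\<^sup>2" "quad3 (xi A) = (2 + 2 * sqrt 2) * (c\<^sup>2)\<^sup>2" "match3 (xi A) = (c\<^sup>2) ^ 3"
proof -
  define e where "e = c\<^sup>2"
  have up: "[1..<7] = [1, 2, 3, 4, 5, 6::nat]" by (simp add: upt_conv_Cons)
  have sq2: "sqrt 2 * sqrt 2 = (2::real)" "sqrt 2 * (sqrt 2 * z) = 2 * z" for z by (simp_all flip: mult.assoc)
  from xi have "match1 (xi A) = 3 * e \<and> lin2 (xi A) = (8 + 2 * sqrt 2) * e \<and> match2 (xi A) = 3 * e\<^sup>2 \<and>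
    lin3 (xi A) = (2 + 4 * sqrt 2) * e \<and> quad3 (xi A) = (2 + 2 * sqrt 2) * e\<^sup>2 \<and> match3 (xi A) = e ^ 3"
    unfolding up e_def[symmetric] list.map list.inject match_defs lin2_def lin3_def quad3_def
    by (elim disjE conjE; simp only:; simp add: algebra_simps power2_eq_square power3_eq_cube sq2)
  then show "match1 (xi A) = 3 * c\<^sup>2" "lin2 (xi A) = (8 + 2 * sqrt 2) * c\<^sup>2" "match2 (xi A) = 3 * (c\<^sup>2)\<^sup>2"
  "lin3 (xi A) = (2 + 4 * sqrt 2) * c\<^sup>2" "quad3 (xi A) = (2 + 2 * sqrt 2) * (c\<^sup>2)\<^sup>2" "match3 (xi A) = (c\<^sup>2) ^ 3"
    unfolding e_def by auto
qed

lemma kippenhahn_poly_factorization: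
  "kippenhahn_poly A x \<theta> =
     - (ellipse_factor (sqrt (2 + sqrt 2)) (- sqrt (2 - sqrt 2)) c x \<theta>
        * ellipse_factor (sqrt (2 - sqrt 2)) (- sqrt (2 + sqrt 2)) c x \<theta>
        * ellipse_factor (sqrt 2) (- sqrt 2) c x \<theta>
        * x)"
proof -
  define p X where "p = (sqrt (2 + sqrt 2) + - sqrt (2 - sqrt 2)) / 2"
    and "X = (sqrt (2 + sqrt 2) - - sqrt (2 - sqrt 2)) / 2"
  define P t e s where "P = complex_of_real p" and "t = complex_of_real (cos \<theta>)"
    and "e = complex_of_real (c\<^sup>2)" and "s = complex_of_real (sqrt 2)"
  \<comment> \<open>The nested roots enter only through \<open>p\<^sup>2\<close> and
    \<open>X\<^sup>2\<close>, so the factorization follows from \<open>2 * P\<^sup>2 = 2 - s\<close>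
    and \<open>s\<^sup>2 = 2\<close>.\<close>
  have p2: "2 * p\<^sup>2 = 2 - sqrt 2" and X2: "X\<^sup>2 = 2 - p\<^sup>2"
    unfolding p_def X_def foci_squares by argo+
  have "2 * P\<^sup>2 = complex_of_real (2 * p\<^sup>2)" by (simp add: P_def)
  then have P: "2 * P\<^sup>2 = 2 - s" unfolding p2 by (simp add: s_def)
  have s: "s\<^sup>2 = 2" unfolding s_def of_real_power[symmetric] by simp
  have X: "complex_of_real (X\<^sup>2) = 2 - P\<^sup>2" unfolding X2 by (simp add: P_def)
  have p': "(sqrt (2 - sqrt 2) + - sqrt (2 + sqrt 2)) / 2 = - p"
    and X': "(sqrt (2 - sqrt 2) - - sqrt (2 + sqrt 2)) / 2 = X" unfolding p_def X_def by argo+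
  have 1: "ellipse_factor (sqrt (2 + sqrt 2)) (- sqrt (2 - sqrt 2)) c x \<theta> =
      (x - P * t)\<^sup>2 - ((2 - P\<^sup>2) * t\<^sup>2 + e)"
    unfolding ellipse_factor_alt p_def[symmetric] X_def[symmetric] X P_def t_def e_def ..
  have 2: "ellipse_factor (sqrt (2 - sqrt 2)) (- sqrt (2 + sqrt 2)) c x \<theta> =
      (x + P * t)\<^sup>2 - ((2 - P\<^sup>2) * t\<^sup>2 + e)"
    unfolding ellipse_factor_alt p' X' X P_def t_def e_def by simp
  have 3: "ellipse_factor (sqrt 2) (- sqrt 2) c x \<theta> = x\<^sup>2 - (2 * t\<^sup>2 + e)"
    unfolding ellipse_factor_alt by (simp add: t_def e_def)
  have "path_poly (\<lambda>j. complex_of_real ((cos \<theta>)\<^sup>2 + xi A j)) x = x ^ 7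
      - complex_of_real (match1 (\<lambda>j. (cos \<theta>)\<^sup>2 + xi A j * 1)) * x ^ 5
      + complex_of_real (match2 (\<lambda>j. (cos \<theta>)\<^sup>2 + xi A j * 1)) * x ^ 3
      - complex_of_real (match3 (\<lambda>j. (cos \<theta>)\<^sup>2 + xi A j * 1)) * x"
    unfolding path_poly_def match_defs by simp
  also have "\<dots> = x ^ 7 - (6 * t\<^sup>2 + 3 * e) * x ^ 5
      + (10 * (t\<^sup>2)\<^sup>2 + (8 + 2 * s) * e * t\<^sup>2 + 3 * e\<^sup>2) * x ^ 3
      - (4 * (t\<^sup>2) ^ 3 + (2 + 4 * s) * e * (t\<^sup>2)\<^sup>2 + (2 + 2 * s) * e\<^sup>2 * t\<^sup>2 + e ^ 3) * x"
    unfolding match_affine xi_coeffs by (simp add: t_def e_def s_def)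
  also have "\<dots> = ((x - P * t)\<^sup>2 - ((2 - P\<^sup>2) * t\<^sup>2 + e)) * ((x + P * t)\<^sup>2 - ((2 - P\<^sup>2) * t\<^sup>2 + e))
      * (x\<^sup>2 - (2 * t\<^sup>2 + e)) * x"
  proof -
    have "((x - P * t)\<^sup>2 - ((2 - P\<^sup>2) * t\<^sup>2 + e)) * ((x + P * t)\<^sup>2 - ((2 - P\<^sup>2) * t\<^sup>2 + e)) =
        (x\<^sup>2 + (2 * P\<^sup>2) * t\<^sup>2 - 2 * t\<^sup>2 - e)\<^sup>2 - 2 * (2 * P\<^sup>2) * t\<^sup>2 * x\<^sup>2"
      by Groebner_Basis.algebra
    also have "\<dots> = (x\<^sup>2 - s * t\<^sup>2 - e)\<^sup>2 - (4 - 2 * s) * t\<^sup>2 * x\<^sup>2"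
      unfolding P by Groebner_Basis.algebra
    finally show ?thesis using s by Groebner_Basis.algebra
  qed
  finally show ?thesis unfolding kippenhahn_poly_reciprocal[OF A] 1 2 3 by simp
qed

lemma kippenhahn_curve_union:
  "kippenhahn_curve A =
     ellipse (sqrt (2 + sqrt 2)) (- sqrt (2 - sqrt 2)) c
     \<union> ellipse (sqrt (2 - sqrt 2)) (- sqrt (2 + sqrt 2)) c
     \<union> ellipse (sqrt 2) (- sqrt 2) c \<union> {0}"
proof -
  define p X where "p = (sqrt (2 + sqrt 2) + - sqrt (2 - sqrt 2)) / 2"
    and "X = (sqrt (2 + sqrt 2) - - sqrt (2 - sqrt 2)) / 2"
  have p': "(sqrt (2 - sqrt 2) + - sqrt (2 + sqrt 2)) / 2 = - p" unfolding p_def by argo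
  have X': "(sqrt (2 - sqrt 2) - - sqrt (2 + sqrt 2)) / 2 = X" unfolding X_def by argo
  have le: "- sqrt (2 + sqrt 2) \<le> sqrt (2 - sqrt 2)" using foci_squares(3) by simp
  have c2: "c\<^sup>2 > 0" using c by simp
  \<comment> \<open>Seven branches for seven eigenvalues: two for each ellipse, and the constant
    0.\<close>
  define I where "I = {(p, X\<^sup>2, 1), (p, X\<^sup>2, -1), (- p, X\<^sup>2, 1), (- p, X\<^sup>2, -1), (0, 2, 1), (0, 2, -1), (0, 2, 0 :: real)}"
  have sq: "u\<^sup>2 - D = 0 \<longleftrightarrow> u = sqrt D \<or> u = - sqrt D" if "D \<ge> 0" for u D :: real
    using that by (metis add.inverse_inverse eq_iff_diff_eq_0 power2_eq_iff real_sqrt_pow2)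
  have factor: "ellipse_factor f g c (complex_of_real x) \<theta> = 0 \<longleftrightarrow>
      x = branch (c\<^sup>2) ((f + g) / 2, ((f - g) / 2)\<^sup>2, 1) \<theta> \<or> x = branch (c\<^sup>2) ((f + g) / 2, ((f - g) / 2)\<^sup>2, -1) \<theta>"
    for f g x \<theta>
    unfolding ellipse_factor_of_real of_real_eq_0_iff branch_def prod.case
    by (subst sq) (auto simp: algebra_simps)
  have "kippenhahn_curve A = {z. \<exists>i\<in>I. \<exists>\<theta>. Re (cis \<theta> * z) = branch (c\<^sup>2) i \<theta> \<and>
      Re (\<i> * cis \<theta> * z) = branch' (c\<^sup>2) i \<theta>}"
  proof (rule kippenhahn_curve_branches)
    show "finite I" by (simp add: I_def)
    show "(branch (c\<^sup>2) i has_real_derivative branch' (c\<^sup>2) i \<theta>) (at \<theta>)" if "i \<in> I" for i \<theta>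
      using that c2 unfolding I_def by (auto intro: branch_deriv)
    have 2: "((sqrt 2 - - sqrt 2) / 2)\<^sup>2 = 2" "(sqrt 2 + - sqrt 2) / 2 = 0" by simp_all
    have 0: "branch (c\<^sup>2) (0, 2, 0) \<theta> = 0" for \<theta> by (simp add: branch_def)
    show "kippenhahn_poly A (complex_of_real x) \<theta> = 0 \<longleftrightarrow> (\<exists>i\<in>I. x = branch (c\<^sup>2) i \<theta>)" for x \<theta>
      unfolding kippenhahn_poly_factorization neg_equal_0_iff_equal mult_eq_0_iff factor of_real_eq_0_iff
        p' X' 2 p_def[symmetric] X_def[symmetric] I_def bex_simps Set.ball_simps 0 by blast
  qed
  also have "\<dots> = {z. z \<in> ellipse (sqrt (2 + sqrt 2)) (- sqrt (2 - sqrt 2)) c \<or>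
      z \<in> ellipse (sqrt (2 - sqrt 2)) (- sqrt (2 + sqrt 2)) c \<or>
      z \<in> ellipse (sqrt 2) (- sqrt 2) c \<or> z = 0}"
  proof (rule Collect_cong)
    fix z
    have E: "(\<exists>\<theta>. Re (cis \<theta> * z) = branch (c\<^sup>2) ((f + g) / 2, ((f - g) / 2)\<^sup>2, \<epsilon>) \<theta> \<and>
        Re (\<i> * cis \<theta> * z) = branch' (c\<^sup>2) ((f + g) / 2, ((f - g) / 2)\<^sup>2, \<epsilon>) \<theta>) \<longleftrightarrow> z \<in> ellipse f g c"
      if "\<epsilon> = 1 \<or> \<epsilon> = -1" "g \<le> f" for f g \<epsilon>
      by (subst branch_envelope[OF c2 _ that(1)]) (simp_all add: mem_ellipse_iff[OF c that(2)])
    have 0: "(\<exists>\<theta>. Re (cis \<theta> * z) = branch (c\<^sup>2) (0, 2, 0) \<theta> \<and> Re (\<i> * cis \<theta> * z) = branch' (c\<^sup>2) (0, 2, 0) \<theta>) \<longleftrightarrow> z = 0"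
    proof
      assume "\<exists>\<theta>. Re (cis \<theta> * z) = branch (c\<^sup>2) (0, 2, 0) \<theta> \<and> Re (\<i> * cis \<theta> * z) = branch' (c\<^sup>2) (0, 2, 0) \<theta>"
      then obtain \<theta> where "Re (cis \<theta> * z) = 0" "Re (\<i> * (cis \<theta> * z)) = 0"
        by (auto simp: branch_def branch'_def mult.assoc)
      then have "cis \<theta> * z = 0" by (intro complex_eqI) auto
      then show "z = 0" by simp
    qed (simp add: branch_def branch'_def)
    note E1 = E[OF _ foci_squares(3), folded p_def X_def]
    note E2 = E[OF _ le, unfolded p' X']
    have E3: "(\<exists>\<theta>. Re (cis \<theta> * z) = branch (c\<^sup>2) (0, 2, \<epsilon>) \<theta> \<and>
        Re (\<i> * cis \<theta> * z) = branch' (c\<^sup>2) (0, 2, \<epsilon>) \<theta>) \<longleftrightarrow> z \<in> ellipse (sqrt 2) (- sqrt 2) c"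
      if "\<epsilon> = 1 \<or> \<epsilon> = -1" for \<epsilon>
      using E[OF that, of "- sqrt 2" "sqrt 2"] by simp
    show "(\<exists>i\<in>I. \<exists>\<theta>. Re (cis \<theta> * z) = branch (c\<^sup>2) i \<theta> \<and> Re (\<i> * cis \<theta> * z) = branch' (c\<^sup>2) i \<theta>) \<longleftrightarrow>
        z \<in> ellipse (sqrt (2 + sqrt 2)) (- sqrt (2 - sqrt 2)) c \<or>
        z \<in> ellipse (sqrt (2 - sqrt 2)) (- sqrt (2 + sqrt 2)) c \<or>
        z \<in> ellipse (sqrt 2) (- sqrt 2) c \<or> z = 0"
      unfolding I_def bex_simps 0 E1[OF disjI1[OF refl]] E1[OF disjI2[OF refl]] E2[OF disjI1[OF refl]]
        E2[OF disjI2[OF refl]] E3[OF disjI1[OF refl]] E3[OF disjI2[OF refl]] by blast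
  qed
  also have "\<dots> = ellipse (sqrt (2 + sqrt 2)) (- sqrt (2 - sqrt 2)) c
     \<union> ellipse (sqrt (2 - sqrt 2)) (- sqrt (2 + sqrt 2)) c
     \<union> ellipse (sqrt 2) (- sqrt 2) c \<union> {0}"
    by blast
  finally show ?thesis .
qed

end

text \<open>The Kippenhahn polynomial is odd in \<open>\<lambda>\<close>, so branches may be
  negated.\<close>

lemma uminus_kippenhahn_curve:
  assumes A: "A \<in> reciprocal_mats 7"
  shows "uminus ` kippenhahn_curve A = kippenhahn_curve A"
proof -
  have neg: "- z \<in> kippenhahn_curve A" if z: "z \<in> kippenhahn_curve A" for z
  proof -
    obtain \<theta> \<mu> \<mu>' where ev: "\<forall>\<^sub>F s in nhds \<theta>. kippenhahn_poly A (complex_of_real (\<mu> s)) s = 0"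
      and \<mu>: "(\<mu> has_real_derivative \<mu>') (at \<theta>)"
      and z: "Re (cis \<theta> * z) = \<mu> \<theta>" "Re (\<i> * cis \<theta> * z) = \<mu>'"
      using z unfolding kippenhahn_curve_def by blast
    have "\<forall>\<^sub>F s in nhds \<theta>. kippenhahn_poly A (complex_of_real (- \<mu> s)) s = 0"
      using ev unfolding kippenhahn_poly_of_real[OF A] path_poly_minus by simp
    moreover have "((\<lambda>s. - \<mu> s) has_real_derivative - \<mu>') (at \<theta>)" by (rule DERIV_minus[OF \<mu>])
    moreover have "Re (cis \<theta> * - z) = - \<mu> \<theta>" "Re (\<i> * cis \<theta> * - z) = - \<mu>'"
      using z by simp_all
    ultimately show ?thesis
      unfolding kippenhahn_curve_def mem_Collect_eq
      by (intro exI[of _ \<theta>] exI[of _ "\<lambda>s. - \<mu> s"] exI[of _ "- \<mu>'"] conjI)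
  qed
  show ?thesis
  proof
    show "kippenhahn_curve A \<subseteq> uminus ` kippenhahn_curve A"
      using neg by (metis add.inverse_inverse image_eqI subsetI)
  qed (use neg in auto)
qed

theorem theorem9:
  fixes A :: "complex mat"
  assumes "A \<in> reciprocal_mats 7"
  shows
    "((\<exists>c>0. ellipse (sqrt (2 + sqrt 2)) (- sqrt (2 - sqrt 2)) c \<subseteq> kippenhahn_curve A) \<longleftrightarrow>
       (\<exists>t>0. map (xi A) [1..<7] = map (\<lambda>y. t * y) xi_vec1 \<or>
              map (xi A) [1..<7] = map (\<lambda>y. t * y) xi_vec2)) \<and>
     (\<forall>c>0. ellipse (sqrt (2 + sqrt 2)) (- sqrt (2 - sqrt 2)) c \<subseteq> kippenhahn_curve A \<longleftrightarrow>
            ellipse (sqrt (2 - sqrt 2)) (- sqrt (2 + sqrt 2)) c \<subseteq> kippenhahn_curve A) \<and>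
     (\<forall>c>0. ellipse (sqrt (2 + sqrt 2)) (- sqrt (2 - sqrt 2)) c \<subseteq> kippenhahn_curve A \<longrightarrow>
       (\<exists>c\<^sub>0>0.
          kippenhahn_curve A =
            ellipse (sqrt (2 + sqrt 2)) (- sqrt (2 - sqrt 2)) c
            \<union> uminus ` ellipse (sqrt (2 + sqrt 2)) (- sqrt (2 - sqrt 2)) c
            \<union> ellipse (sqrt 2) (- sqrt 2) c\<^sub>0
            \<union> {0} \<and>
          (\<forall>x \<theta>. kippenhahn_poly A x \<theta> =
             - (ellipse_factor (sqrt (2 + sqrt 2)) (- sqrt (2 - sqrt 2)) c x \<theta>
                * ellipse_factor (sqrt (2 - sqrt 2)) (- sqrt (2 + sqrt 2)) c x \<theta>
                * ellipse_factor (sqrt 2) (- sqrt 2) c\<^sub>0 x \<theta>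
                * x)) \<and>
          c\<^sub>0 = c))"
    (is "(?ex \<longleftrightarrow> ?xi) \<and> ?sym \<and> ?shape")
proof (intro conjI)
  have neg: "uminus ` ellipse (sqrt (2 + sqrt 2)) (- sqrt (2 - sqrt 2)) c =
      ellipse (sqrt (2 - sqrt 2)) (- sqrt (2 + sqrt 2)) c" for c
    unfolding uminus_ellipse by simp
  show "?ex \<longleftrightarrow> ?xi"
    unfolding xi_multiple_iff
  proof
    assume "\<exists>c>0. ellipse (sqrt (2 + sqrt 2)) (- sqrt (2 - sqrt 2)) c \<subseteq> kippenhahn_curve A"
    then show "\<exists>c>0. map (xi A) [1..<7] = map ((*) (c\<^sup>2)) [2 * sqrt 2 - 2, 3 - 2 * sqrt 2, 0, 1, 0, 1] \<or>
      map (xi A) [1..<7] = map ((*) (c\<^sup>2)) [1, 0, 1, 0, 3 - 2 * sqrt 2, 2 * sqrt 2 - 2]"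
      using ellipse_subset_curve_imp_xi[OF assms] by blast
  next
    assume "\<exists>c>0. map (xi A) [1..<7] = map ((*) (c\<^sup>2)) [2 * sqrt 2 - 2, 3 - 2 * sqrt 2, 0, 1, 0, 1] \<or>
      map (xi A) [1..<7] = map ((*) (c\<^sup>2)) [1, 0, 1, 0, 3 - 2 * sqrt 2, 2 * sqrt 2 - 2]"
    then show "\<exists>c>0. ellipse (sqrt (2 + sqrt 2)) (- sqrt (2 - sqrt 2)) c \<subseteq> kippenhahn_curve A"
      using kippenhahn_curve_union[OF assms] by blast
  qed
  show ?sym
  proof (intro allI impI)
    fix c :: real
    show "ellipse (sqrt (2 + sqrt 2)) (- sqrt (2 - sqrt 2)) c \<subseteq> kippenhahn_curve A \<longleftrightarrow>
            ellipse (sqrt (2 - sqrt 2)) (- sqrt (2 + sqrt 2)) c \<subseteq> kippenhahn_curve A"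
      \<comment> \<open>Only the second occurrence of the curve is replaced by its reflection, so
        that both sides of that inclusion are reflected.\<close>
      unfolding neg[symmetric]
      by (subst (2) uminus_kippenhahn_curve[OF assms, symmetric]) (simp add: inj_image_subset_iff)
  qed
  show ?shape
  proof (intro allI impI)
    fix c :: real
    assume c: "c > 0" and sub: "ellipse (sqrt (2 + sqrt 2)) (- sqrt (2 - sqrt 2)) c \<subseteq> kippenhahn_curve A"
    note xi = ellipse_subset_curve_imp_xi[OF assms c sub]
    show "\<exists>c\<^sub>0>0.
          kippenhahn_curve A =
            ellipse (sqrt (2 + sqrt 2)) (- sqrt (2 - sqrt 2)) c
            \<union> uminus ` ellipse (sqrt (2 + sqrt 2)) (- sqrt (2 - sqrt 2)) c
            \<union> ellipse (sqrt 2) (- sqrt 2) c\<^sub>0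
            \<union> {0} \<and>
          (\<forall>x \<theta>. kippenhahn_poly A x \<theta> =
             - (ellipse_factor (sqrt (2 + sqrt 2)) (- sqrt (2 - sqrt 2)) c x \<theta>
                * ellipse_factor (sqrt (2 - sqrt 2)) (- sqrt (2 + sqrt 2)) c x \<theta>
                * ellipse_factor (sqrt 2) (- sqrt 2) c\<^sub>0 x \<theta>
                * x)) \<and>
          c\<^sub>0 = c"
      using kippenhahn_curve_union[OF assms c xi] kippenhahn_poly_factorization[OF assms c xi] c
      unfolding neg by blast
  qed
qed

end
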